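(* Let $\mu$ be a $\sigma$-finite complex Borel measure on $\mathbb{C}_-$ such that $\int_{\mathbb{C}_-} |e^{tp}|\, d|\mu|(p) < \infty$ for all $t>0$, and let $h(t)=\int_{\mathbb{C}_-} e^{tp}\, d\mu(p)$ for $t>0$. Let $w:(0,\infty)\to(0,\infty)$ be measurable and suppose that for each $p\in\mathbb{C}_-$ the function $\psi_p(t)=w(t)e^{pt}$ belongs to $L^2(0,\infty)$. If $$\int_{\mathbb{C}_-} \|\psi_p\|_2^2 \, d|\mu|(p) < \infty, \qquad ( * )$$ then the weighted Hankel operator $\Gamma_{h,w}$ on $L^2(0,\infty)$ is nuclear. Moreover, in the case that $\mu\ge 0$ and $\mu$ is supported on $\mathbb{R}_-$, condition $( * )$ is necessary and sufficient for $\Gamma_{h,w}$ to be nuclear.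
   Context: $\mathbb{C}_-=\{p\in\mathbb{C}:\operatorname{Re} p<0\}$ is the open left half-plane and $\mathbb{R}_-=(-\infty,0)$. The complex measure $\mu$ need not be finite: it is given by $d\mu=\theta\, d|\mu|$ with $|\mu|$ a $\sigma$-finite positive Borel measure on $\mathbb{C}_-$ and $\theta$ a measurable function with $|\theta|=1$. The weighted Hankel operator $\Gamma_{h,w}$ is $$(\Gamma_{h,w}u)(t)=\int_0^\infty w(t)\,h(t+\tau)\,w(\tau)\,u(\tau)\,d\tau .$$ A bounded operator on a Hilbert space is nuclear (trace class) if $\sum_{k\ge1}\sigma_k<\infty$, where $\sigma_k(\Gamma)=\inf\{\|\Gamma-T\|:\operatorname{rank}(T)<k\}$ are its singular values. $\|\cdot\|_2$ is the norm of $L^2(0,\infty)$. *)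

theory Defs
  imports "HOL-Analysis.Analysis"
begin

section \<open>The space \<open>L\<^sup>2(0,\<infinity>)\<close>\<close>

text \<open>Elements of \<open>L\<^sup>2(0,\<infinity>)\<close> are handled through representatives: functions on \<open>\<real>\<close> of which only
  the values on \<open>(0,\<infinity>)\<close> matter, with Lebesgue-a.e. equality in place of equality.\<close>

abbreviation halfline :: "real measure" where
  "halfline \<equiv> lebesgue_on {0<..}"

definition L2 :: "(real \<Rightarrow> complex) set" where
  "L2 = {f. f \<in> borel_measurable halfline \<and> integrable halfline (\<lambda>t. (cmod (f t))\<^sup>2)}"

definition l2norm :: "(real \<Rightarrow> complex) \<Rightarrow> real" where
  "l2norm f = sqrt (\<integral>t. (cmod (f t))\<^sup>2 \<partial>halfline)"

definition ae_eq :: "(real \<Rightarrow> complex) \<Rightarrow> (real \<Rightarrow> complex) \<Rightarrow> bool" where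
  "ae_eq f g \<longleftrightarrow> (AE t in halfline. f t = g t)"


section \<open>Bounded and nuclear operators on \<open>L\<^sup>2(0,\<infinity>)\<close>\<close>

type_synonym l2op = "(real \<Rightarrow> complex) \<Rightarrow> (real \<Rightarrow> complex)"

definition bounded_op :: "l2op \<Rightarrow> bool" where
  "bounded_op T \<longleftrightarrow>
     (\<forall>u\<in>L2. T u \<in> L2) \<and>
     (\<forall>u\<in>L2. \<forall>v\<in>L2. ae_eq u v \<longrightarrow> ae_eq (T u) (T v)) \<and>
     (\<forall>u\<in>L2. \<forall>v\<in>L2. \<forall>a b. ae_eq (T (\<lambda>t. a * u t + b * v t)) (\<lambda>t. a * T u t + b * T v t)) \<and>
     (\<exists>C. \<forall>u\<in>L2. l2norm (T u) \<le> C * l2norm u)"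

definition op_norm :: "l2op \<Rightarrow> real" where
  "op_norm T = (SUP u\<in>{u\<in>L2. l2norm u \<le> 1}. l2norm (T u))"

text \<open>\<open>rank T < k\<close>: modulo a.e. equality, the range of \<open>T\<close> is spanned by fewer than \<open>k\<close> of its
  elements.\<close>

definition rank_less :: "l2op \<Rightarrow> nat \<Rightarrow> bool" where
  "rank_less T k \<longleftrightarrow>
     (\<exists>B. finite B \<and> card B < k \<and> B \<subseteq> T ` L2 \<and>
          (\<forall>u\<in>L2. \<exists>c. ae_eq (T u) (\<lambda>t. \<Sum>b\<in>B. c b * b t)))"

text \<open>Meaningful for \<open>k \<ge> 1\<close> (for \<open>k = 0\<close> the infimum is over the empty set).\<close>

definition singular_value :: "l2op \<Rightarrow> nat \<Rightarrow> real" where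
  "singular_value G k =
     (INF T\<in>{T. bounded_op T \<and> rank_less T k}. op_norm (\<lambda>u t. G u t - T u t))"

definition nuclear :: "l2op \<Rightarrow> bool" where
  "nuclear G \<longleftrightarrow> bounded_op G \<and> summable (\<lambda>k. singular_value G (Suc k))"


section \<open>Weighted Hankel operators\<close>

definition hankel_integrand ::
  "(real \<Rightarrow> complex) \<Rightarrow> (real \<Rightarrow> real) \<Rightarrow> (real \<Rightarrow> complex) \<Rightarrow> real \<Rightarrow> real \<Rightarrow> complex" where
  "hankel_integrand h w u t \<tau> = of_real (w t) * h (t + \<tau>) * of_real (w \<tau>) * u \<tau>"

definition weighted_hankel :: "(real \<Rightarrow> complex) \<Rightarrow> (real \<Rightarrow> real) \<Rightarrow> l2op" where
  "weighted_hankel h w = (\<lambda>u t. \<integral>\<tau>. hankel_integrand h w u t \<tau> \<partial>halfline)"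

text \<open>The Bochner integral of a non-integrable function is \<open>0\<close> by convention, so the convergence of
  the defining integrals, for every \<open>u\<close> in \<open>L\<^sup>2\<close> and almost every \<open>t\<close>, has to be asked for
  separately.\<close>

definition hankel_defined :: "(real \<Rightarrow> complex) \<Rightarrow> (real \<Rightarrow> real) \<Rightarrow> bool" where
  "hankel_defined h w \<longleftrightarrow>
     (\<forall>u\<in>L2. AE t in halfline. integrable halfline (hankel_integrand h w u t))"

definition weighted_hankel_nuclear :: "(real \<Rightarrow> complex) \<Rightarrow> (real \<Rightarrow> real) \<Rightarrow> bool" where
  "weighted_hankel_nuclear h w \<longleftrightarrow> hankel_defined h w \<and> nuclear (weighted_hankel h w)"

definition psi :: "(real \<Rightarrow> real) \<Rightarrow> complex \<Rightarrow> real \<Rightarrow> complex" where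
  "psi w p t = of_real (w t) * exp (p * of_real t)"


section \<open>\<open>\<sigma>\<close>-finite complex measures on the open left half-plane\<close>

definition left_half_plane :: "complex set" where
  "left_half_plane = {p. Re p < 0}"

text \<open>A complex measure \<open>\<mu>\<close>, not necessarily finite, is given by its polar decomposition
  \<open>d\<mu> = \<theta> d|\<mu>|\<close>; below \<open>M\<close> is \<open>|\<mu>|\<close>.\<close>

definition sigma_finite_complex_measure :: "complex measure \<Rightarrow> (complex \<Rightarrow> complex) \<Rightarrow> bool" where
  "sigma_finite_complex_measure M \<theta> \<longleftrightarrow>
     sets M = sets (restrict_space borel left_half_plane) \<and> sigma_finite_measure M \<and>
     \<theta> \<in> borel_measurable M \<and> (\<forall>p\<in>left_half_plane. cmod (\<theta> p) = 1)"

definition cm_integral ::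
  "complex measure \<Rightarrow> (complex \<Rightarrow> complex) \<Rightarrow> (complex \<Rightarrow> complex) \<Rightarrow> complex" where
  "cm_integral M \<theta> f = (\<integral>p. f p * \<theta> p \<partial>M)"

text \<open>\<open>\<mu> \<ge> 0\<close>: the value \<open>\<mu>(A)\<close> is a nonnegative real whenever it is defined as a complex number,
  that is, whenever \<open>|\<mu>|(A) < \<infinity>\<close>.\<close>

definition cm_nonneg :: "complex measure \<Rightarrow> (complex \<Rightarrow> complex) \<Rightarrow> bool" where
  "cm_nonneg M \<theta> \<longleftrightarrow>
     (\<forall>A\<in>sets M. emeasure M A < \<infinity> \<longrightarrow> cm_integral M \<theta> (indicator A) \<in> \<real>\<^sub>\<ge>\<^sub>0)"

definition supported_on_neg_reals :: "complex measure \<Rightarrow> bool" where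
  "supported_on_neg_reals M \<longleftrightarrow> emeasure M (left_half_plane - of_real ` {..<0}) = 0"

end

theory Submission
  imports Defs
begin

text \<open>Write \<open>a\<^sub>u(p) = \<integral> \<psi>\<^sub>p u dt\<close>. Formally \<open>\<Gamma>\<close> is the superposition of rank-one operators given by
  \<open>\<integral> (\<Gamma> u) v dt = \<integral> \<theta> a\<^sub>u a\<^sub>v d|\<mu>|\<close>, so \<open>|\<integral> (\<Gamma> u) v| \<le> \<parallel>a\<^sub>u\<parallel> \<parallel>a\<^sub>v\<parallel>\<close> in \<open>L\<^sup>2(|\<mu>|)\<close>.

  Sufficiency. Choose orthonormal \<open>e\<^sub>0, e\<^sub>1, \<dots>\<close> greedily: \<open>e\<^sub>k\<close> maximizes \<open>\<parallel>a\<^sub>e\<parallel>\<^sup>2\<close> up to a factor 2 among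
  the unit vectors orthogonal to its predecessors. With \<open>P\<close> the orthogonal projection onto
  \<open>e\<^sub>0, \<dots>, e\<^bsub>k-1\<^esub>\<close> and \<open>P'\<close> its complex conjugate, \<open>(1 - P') \<Gamma> (1 - P)\<close> differs from \<open>\<Gamma>\<close> by rank at most
  \<open>2k\<close> and has norm at most \<open>2 \<parallel>a\<^sub>e\<parallel>\<^sup>2\<close> for \<open>e = e\<^sub>k\<close>. By Bessel's inequality these bounds sum to at most
  \<open>2 \<integral> \<parallel>\<psi>\<^sub>p\<parallel>\<^sup>2 d|\<mu>|\<close>; no spectral theory is needed.

  Necessity. Given an orthonormal family \<open>e\<^sub>1, \<dots>, e\<^sub>N\<close> and operators \<open>T\<^sub>k\<close> of rank less than \<open>k\<close>, counting
  equations yields an orthonormal basis \<open>f\<^sub>1, \<dots>, f\<^sub>N\<close> of its span with \<open>T\<^sub>k f\<^sub>k = 0\<close>. Hence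
  \<open>|\<Sum> \<langle>\<Gamma> e\<^sub>j, e\<^sub>j\<rangle>| = |\<Sum> \<langle>(\<Gamma> - T\<^sub>k) f\<^sub>k, f\<^sub>k\<rangle>| \<le> \<Sum> \<parallel>\<Gamma> - T\<^sub>k\<parallel>\<close>, which bounds the left side by the sum of the
  singular values. For the \<open>e\<^sub>j\<close> take normalized indicators of cells on which \<open>w\<close> and \<open>e\<^bsup>pt\<^esup>\<close> vary by at most
  a constant factor, uniformly for \<open>-n \<le> p < 0\<close>: then \<open>\<Sum> \<langle>\<Gamma> e\<^sub>j, e\<^sub>j\<rangle>\<close> dominates a fixed multiple of
  \<open>\<integral> \<parallel>\<psi>\<^sub>p\<parallel>\<^sup>2 d\<mu>\<close> truncated in \<open>p\<close> and \<open>t\<close>, and the truncation is removed by monotone convergence.\<close>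

section \<open>Inner products on \<open>L\<^sup>2(0,\<infinity>)\<close>\<close>

text \<open>Fubini and Tonelli on products of the half-line with \<open>M\<close> rest on
  this.\<close>

lemma sigma_finite_halfline: "sigma_finite_measure halfline"
proof -
  have "sigma_finite_measure (lebesgue :: real measure)"
  proof
    show "\<exists>A::real set set. countable A \<and> A \<subseteq> sets lebesgue \<and> \<Union>A = space lebesgue
        \<and> (\<forall>a\<in>A. emeasure lebesgue a \<noteq> \<infinity>)"
    proof (intro exI[of _ "range (\<lambda>n::nat. {- real n..real n})"] conjI)
      have "\<exists>n. - real n \<le> x \<and> x \<le> real n" for x
      proof -
        obtain n where "\<bar>x\<bar> \<le> real n" using real_arch_simple by blast
        then have "- real n \<le> x \<and> x \<le> real n" by linarith
        then show ?thesis by blast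
      qed
      then show "\<Union> (range (\<lambda>n::nat. {- real n..real n})) = space lebesgue" by auto
    qed auto
  qed
  then show ?thesis
    by (rule sigma_finite_measure_restrict_space) auto
qed

section \<open>Representatives in \<open>L2\<close>: domination and linear structure\<close>

lemma L2_measurable: "u \<in> L2 \<Longrightarrow> u \<in> borel_measurable halfline"
  by (simp add: L2_def)

lemma L2_integrable: "u \<in> L2 \<Longrightarrow> integrable halfline (\<lambda>t. (cmod (u t))\<^sup>2)"
  by (simp add: L2_def)

lemma l2norm_nonneg [simp]: "0 \<le> l2norm u"
  by (simp add: l2norm_def)

lemma l2norm_power2: "(l2norm u)\<^sup>2 = (\<integral>t. (cmod (u t))\<^sup>2 \<partial>halfline)"
  by (simp add: l2norm_def)

lemma nn_integral_L2:
  "u \<in> L2 \<Longrightarrow> (\<integral>\<^sup>+t. ennreal ((cmod (u t))\<^sup>2) \<partial>halfline) = ennreal ((l2norm u)\<^sup>2)"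
  by (simp add: l2norm_power2 nn_integral_eq_integral L2_integrable)

lemma L2_bound:
  assumes "u \<in> borel_measurable halfline" "v \<in> L2" "\<And>t. t > 0 \<Longrightarrow> cmod (u t) \<le> c * cmod (v t)"
  shows "u \<in> L2"
proof -
  have "integrable halfline (\<lambda>t. (cmod (u t))\<^sup>2)"
  proof (rule Bochner_Integration.integrable_bound)
    show "integrable halfline (\<lambda>t. c\<^sup>2 * (cmod (v t))\<^sup>2)"
      using assms(2) by (auto simp: L2_def)
    show "AE t in halfline. norm ((cmod (u t))\<^sup>2) \<le> norm (c\<^sup>2 * (cmod (v t))\<^sup>2)"
      using assms(3) by (intro AE_I2) (auto simp: power_mult_distrib[symmetric] intro!: power_mono)
  qed (use assms in measurable)
  with assms show ?thesis by (simp add: L2_def)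
qed

lemma L2_mult_integrable:
  assumes "u \<in> L2" "v \<in> L2"
  shows "integrable halfline (\<lambda>t. u t * v t)"
proof (rule Bochner_Integration.integrable_bound)
  show "integrable halfline (\<lambda>t. (cmod (u t))\<^sup>2 + (cmod (v t))\<^sup>2)"
    using assms by (auto simp: L2_def)
  show "(\<lambda>t. u t * v t) \<in> borel_measurable halfline"
    using assms[THEN L2_measurable] by measurable
  have "x * y \<le> x\<^sup>2 + y\<^sup>2" if "0 \<le> x" "0 \<le> y" for x y :: real
    using sum_squares_bound[of x y] that mult_nonneg_nonneg[of x y] by linarith
  then show "AE t in halfline. norm (u t * v t) \<le> norm ((cmod (u t))\<^sup>2 + (cmod (v t))\<^sup>2)"
    by (simp add: norm_mult)
qed

lemma borel_measurable_cnj [measurable]: "cnj \<in> borel_measurable borel"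
  by (intro borel_measurable_continuous_onI continuous_intros)

lemma L2_cnj: "u \<in> L2 \<Longrightarrow> (\<lambda>t. cnj (u t)) \<in> L2"
  by (rule L2_bound[where v = u and c = 1])
     (simp_all add: L2_measurable measurable_compose[OF L2_measurable borel_measurable_cnj])

lemma l2norm_cnj: "l2norm (\<lambda>t. cnj (u t)) = l2norm u"
  by (simp add: l2norm_def)

lemma L2_zero: "(\<lambda>t. 0) \<in> L2"
  by (simp add: L2_def)

lemma L2_scale: "u \<in> L2 \<Longrightarrow> (\<lambda>t. a * u t) \<in> L2"
  by (rule L2_bound[where v = u and c = "cmod a"]) (auto simp: L2_def norm_mult)

lemma L2_add:
  assumes "u \<in> L2" "v \<in> L2"
  shows "(\<lambda>t. u t + v t) \<in> L2"
proof -
  have "integrable halfline (\<lambda>t. (cmod (u t + v t))\<^sup>2)"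
  proof (rule Bochner_Integration.integrable_bound)
    show "integrable halfline (\<lambda>t. 2 * (cmod (u t))\<^sup>2 + 2 * (cmod (v t))\<^sup>2)"
      using assms by (auto simp: L2_def)
    have "(cmod (x + y))\<^sup>2 \<le> 2 * (cmod x)\<^sup>2 + 2 * (cmod y)\<^sup>2" for x y
    proof -
      have "(cmod (x + y))\<^sup>2 \<le> (cmod x + cmod y)\<^sup>2"
        by (intro power_mono norm_triangle_ineq) auto
      then show ?thesis using sum_squares_bound[of "cmod x" "cmod y"]
        by (simp add: power2_sum)
    qed
    then show "AE t in halfline. norm ((cmod (u t + v t))\<^sup>2)
        \<le> norm (2 * (cmod (u t))\<^sup>2 + 2 * (cmod (v t))\<^sup>2)"
      by (intro AE_I2) (simp only: real_norm_def abs_power2, metis abs_ge_self order_trans)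
  qed (use assms[THEN L2_measurable] in measurable)
  moreover have "(\<lambda>t. u t + v t) \<in> borel_measurable halfline"
    using assms[THEN L2_measurable] by measurable
  ultimately show ?thesis by (simp add: L2_def)
qed

lemma L2_diff: "u \<in> L2 \<Longrightarrow> v \<in> L2 \<Longrightarrow> (\<lambda>t. u t - v t) \<in> L2"
  using L2_add[of u "\<lambda>t. (- 1) * v t"] L2_scale[of v "- 1"] by simp

lemma L2_lin: "u \<in> L2 \<Longrightarrow> v \<in> L2 \<Longrightarrow> (\<lambda>t. a * u t + b * v t) \<in> L2"
  by (intro L2_add L2_scale)

lemma L2_sum: "(\<And>i. i \<in> I \<Longrightarrow> f i \<in> L2) \<Longrightarrow> (\<lambda>t. \<Sum>i\<in>I. f i t) \<in> L2"
  by (induction I rule: infinite_finite_induct) (auto intro: L2_zero L2_add)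

text \<open>The bilinear pairing of \<open>\<Gamma> u\<close> with \<open>v\<close> is the inner
  product of \<open>\<Gamma> u\<close> with the conjugate of \<open>v\<close>; this is the source of
  the conjugates in later statements.\<close>

definition l2_inner :: "(real \<Rightarrow> complex) \<Rightarrow> (real \<Rightarrow> complex) \<Rightarrow> complex" where
  "l2_inner u v = (\<integral>t. u t * cnj (v t) \<partial>halfline)"

lemma l2_inner_cnj: "l2_inner v u = cnj (l2_inner u v)"
proof -
  have "l2_inner v u = (\<integral>t. cnj (u t * cnj (v t)) \<partial>halfline)"
    by (simp add: l2_inner_def mult.commute)
  then show ?thesis unfolding l2_inner_def Bochner_Integration.integral_cnj .
qed

lemma l2_inner_self: "l2_inner u u = of_real ((l2norm u)\<^sup>2)"
  by (simp add: l2_inner_def l2norm_power2 complex_norm_square[symmetric] flip: integral_complex_of_real)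

lemma l2_inner_add_left:
  "u \<in> L2 \<Longrightarrow> v \<in> L2 \<Longrightarrow> x \<in> L2 \<Longrightarrow> l2_inner (\<lambda>t. u t + v t) x = l2_inner u x + l2_inner v x"
  by (simp add: l2_inner_def distrib_right Bochner_Integration.integral_add L2_mult_integrable L2_cnj)

lemma l2_inner_diff_left:
  "u \<in> L2 \<Longrightarrow> v \<in> L2 \<Longrightarrow> x \<in> L2 \<Longrightarrow> l2_inner (\<lambda>t. u t - v t) x = l2_inner u x - l2_inner v x"
  by (simp add: l2_inner_def left_diff_distrib Bochner_Integration.integral_diff L2_mult_integrable L2_cnj)

lemma l2_inner_scale_left: "l2_inner (\<lambda>t. a * u t) x = a * l2_inner u x"
  by (simp add: l2_inner_def mult.assoc)

lemma l2_inner_scale_right: "l2_inner u (\<lambda>t. a * x t) = cnj a * l2_inner u x"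
  by (simp add: l2_inner_def mult.left_commute[of _ "cnj a"])

lemma l2_inner_zero_left: "l2_inner (\<lambda>t. 0) x = 0"
  by (simp add: l2_inner_def)

lemma l2_inner_sum_left:
  "(\<And>i. i \<in> I \<Longrightarrow> f i \<in> L2) \<Longrightarrow> x \<in> L2 \<Longrightarrow>
    l2_inner (\<lambda>t. \<Sum>i\<in>I. f i t) x = (\<Sum>i\<in>I. l2_inner (f i) x)"
  by (induction I rule: infinite_finite_induct)
     (auto simp: l2_inner_zero_left l2_inner_add_left L2_sum)

lemma l2_inner_sum_right:
  "(\<And>i. i \<in> I \<Longrightarrow> f i \<in> L2) \<Longrightarrow> x \<in> L2 \<Longrightarrow>
    l2_inner x (\<lambda>t. \<Sum>i\<in>I. f i t) = (\<Sum>i\<in>I. l2_inner x (f i))"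
  by (subst l2_inner_cnj) (simp add: l2_inner_sum_left l2_inner_cnj[symmetric])

text \<open>Formulated over an arbitrary measure because it is applied both in \<open>t\<close> on
  the half-line and in \<open>p\<close> over \<open>M\<close>. It is derived from the squared
  inequality for nonnegative integrals.\<close>

lemma integral_Cauchy_Schwarz:
  fixes f g :: "'a \<Rightarrow> complex"
  assumes f: "f \<in> borel_measurable N" "integrable N (\<lambda>x. (cmod (f x))\<^sup>2)"
    and g: "g \<in> borel_measurable N" "integrable N (\<lambda>x. (cmod (g x))\<^sup>2)"
  shows "(\<integral>x. cmod (f x) * cmod (g x) \<partial>N) \<le> sqrt (\<integral>x. (cmod (f x))\<^sup>2 \<partial>N) * sqrt (\<integral>x. (cmod (g x))\<^sup>2 \<partial>N)"
    (is "?I \<le> sqrt ?F * sqrt ?G")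
proof (cases "integrable N (\<lambda>x. cmod (f x) * cmod (g x))")
  case int: True
  have I0: "0 \<le> ?I" and F0: "0 \<le> ?F" and G0: "0 \<le> ?G" by (intro integral_nonneg_AE; simp)+
  have "ennreal (?I\<^sup>2) = (ennreal ?I)\<^sup>2" using I0 by (simp add: ennreal_power)
  also have "ennreal ?I = (\<integral>\<^sup>+x. ennreal (cmod (f x)) * ennreal (cmod (g x)) \<partial>N)"
    using int by (simp add: nn_integral_eq_integral flip: ennreal_mult')
  also have "\<dots>\<^sup>2 \<le> (\<integral>\<^sup>+x. (ennreal (cmod (f x)))\<^sup>2 \<partial>N) * (\<integral>\<^sup>+x. (ennreal (cmod (g x)))\<^sup>2 \<partial>N)"
    by (rule Cauchy_Schwarz_nn_integral; rule measurable_compose[OF _ measurable_ennreal])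
       (rule measurable_compose[OF f(1) borel_measurable_norm] measurable_compose[OF g(1) borel_measurable_norm])+
  also have "\<dots> = ennreal ?F * ennreal ?G"
    by (simp add: ennreal_power nn_integral_eq_integral f g)
  also have "\<dots> = ennreal ((sqrt ?F * sqrt ?G)\<^sup>2)"
    using F0 G0 by (simp add: power_mult_distrib ennreal_mult')
  finally have "?I\<^sup>2 \<le> (sqrt ?F * sqrt ?G)\<^sup>2"
    using F0 G0 by (simp add: ennreal_le_iff)
  then show ?thesis using F0 G0 by (auto intro: power2_le_imp_le)
\<comment> \<open>The remaining case: a non-integrable product has integral 0 by convention, and the
  right side is nonnegative.\<close>
qed (simp add: not_integrable_integral_eq integral_nonneg_AE)

lemma integral_cmod_mult_le:
  "u \<in> L2 \<Longrightarrow> v \<in> L2 \<Longrightarrow>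
    (\<integral>t. cmod (u t) * cmod (v t) \<partial>halfline) \<le> l2norm u * l2norm v"
  using integral_Cauchy_Schwarz[of u halfline v] by (simp add: L2_def l2norm_def)

lemma l2_Cauchy_Schwarz:
  assumes "u \<in> L2" "v \<in> L2"
  shows "cmod (l2_inner u v) \<le> l2norm u * l2norm v"
proof -
  have "cmod (l2_inner u v) \<le> (\<integral>t. cmod (u t) * cmod (v t) \<partial>halfline)"
    unfolding l2_inner_def
    by (rule order_trans[OF integral_norm_bound]) (simp add: norm_mult)
  then show ?thesis using integral_cmod_mult_le[OF assms] by linarith
qed

lemma l2norm_scale: "l2norm (\<lambda>t. a * u t) = cmod a * l2norm u"
  by (simp add: l2norm_def norm_mult power_mult_distrib real_sqrt_mult)

lemma l2norm_zero [simp]: "l2norm (\<lambda>t. 0) = 0"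
  by (simp add: l2norm_def)

lemma l2norm_add_power2:
  assumes "u \<in> L2" "v \<in> L2"
  shows "(l2norm (\<lambda>t. u t + v t))\<^sup>2 = (l2norm u)\<^sup>2 + 2 * Re (l2_inner u v) + (l2norm v)\<^sup>2"
proof -
  let ?s = "\<lambda>t. u t + v t"
  have s: "?s \<in> L2" using assms by (rule L2_add)
  have "l2_inner ?s ?s = l2_inner u ?s + l2_inner v ?s"
    by (rule l2_inner_add_left[OF assms s])
  also have "\<dots> = cnj (l2_inner ?s u) + cnj (l2_inner ?s v)"
    by (simp flip: l2_inner_cnj)
  also have "\<dots> = l2_inner u u + cnj (l2_inner v u) + (l2_inner v u + l2_inner v v)"
    by (simp add: l2_inner_add_left assms flip: l2_inner_cnj)
  finally have "Re (l2_inner ?s ?s) = Re (l2_inner u u + cnj (l2_inner v u) + (l2_inner v u + l2_inner v v))"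
    by (rule arg_cong)
  moreover have "Re (l2_inner v u) = Re (l2_inner u v)"
    by (subst l2_inner_cnj) simp
  ultimately show ?thesis
    by (simp add: l2_inner_self)
qed

lemma l2norm_triangle:
  assumes "u \<in> L2" "v \<in> L2"
  shows "l2norm (\<lambda>t. u t + v t) \<le> l2norm u + l2norm v"
proof (rule power2_le_imp_le)
  have "Re (l2_inner u v) \<le> l2norm u * l2norm v"
    using l2_Cauchy_Schwarz[OF assms] complex_Re_le_cmod[of "l2_inner u v"] by linarith
  then show "(l2norm (\<lambda>t. u t + v t))\<^sup>2 \<le> (l2norm u + l2norm v)\<^sup>2"
    by (simp add: l2norm_add_power2[OF assms] power2_sum)
qed simp

lemma l2norm_diff_le:
  assumes "u \<in> L2" "v \<in> L2"
  shows "l2norm (\<lambda>t. u t - v t) \<le> l2norm u + l2norm v"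
  using l2norm_triangle[OF assms(1) L2_scale[OF assms(2), of "- 1"]]
  by (simp add: l2norm_scale[of "- 1" v, simplified])

lemma l2_inner_ae_cong_left:
  assumes "u \<in> L2" "v \<in> L2" "x \<in> L2" "ae_eq u v"
  shows "l2_inner u x = l2_inner v x"
proof -
  have "u \<in> borel_measurable halfline" "v \<in> borel_measurable halfline" "x \<in> borel_measurable halfline"
    using assms by (auto simp: L2_def)
  then have "(\<lambda>t. u t * cnj (x t)) \<in> borel_measurable halfline"
    "(\<lambda>t. v t * cnj (x t)) \<in> borel_measurable halfline"
    by (auto intro!: borel_measurable_times measurable_compose[OF _ borel_measurable_cnj])
  then show ?thesis
    unfolding l2_inner_def using assms(4)
    by (intro integral_cong_AE) (auto simp: ae_eq_def elim: eventually_mono)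
qed

text \<open>Turns a vanishing residual into an expansion valid almost everywhere.\<close>

lemma ae_eq_iff_l2norm_diff:
  assumes "u \<in> L2" "v \<in> L2"
  shows "ae_eq u v \<longleftrightarrow> l2norm (\<lambda>t. u t - v t) = 0"
proof -
  have "integrable halfline (\<lambda>t. (cmod (u t - v t))\<^sup>2)"
    using L2_diff[OF assms] by (simp add: L2_def)
  then have "(\<integral>t. (cmod (u t - v t))\<^sup>2 \<partial>halfline) = 0 \<longleftrightarrow> (AE t in halfline. (cmod (u t - v t))\<^sup>2 = 0)"
    by (intro integral_nonneg_eq_0_iff_AE) auto
  then show ?thesis by (simp add: ae_eq_def l2norm_def)
qed

section \<open>Calculus of almost-everywhere equality\<close>

lemma ae_eq_refl [simp]: "ae_eq u u"
  by (simp add: ae_eq_def)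

lemma ae_eq_sym: "ae_eq u v \<Longrightarrow> ae_eq v u"
  unfolding ae_eq_def by (auto elim: eventually_mono)

lemma ae_eq_trans [trans]: "ae_eq u v \<Longrightarrow> ae_eq v x \<Longrightarrow> ae_eq u x"
  unfolding ae_eq_def by (auto elim: eventually_elim2)

lemma ae_eq_pointwise: "(\<And>t. t > 0 \<Longrightarrow> u t = v t) \<Longrightarrow> ae_eq u v"
  unfolding ae_eq_def by (rule AE_I2) simp

lemma ae_eq_lin: "ae_eq u u' \<Longrightarrow> ae_eq v v' \<Longrightarrow> ae_eq (\<lambda>t. a * u t + b * v t) (\<lambda>t. a * u' t + b * v' t)"
  unfolding ae_eq_def by (auto elim: eventually_elim2)

lemma ae_eq_add: "ae_eq u u' \<Longrightarrow> ae_eq v v' \<Longrightarrow> ae_eq (\<lambda>t. u t + v t) (\<lambda>t. u' t + v' t)"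
  unfolding ae_eq_def by (auto elim: eventually_elim2)

lemma ae_eq_diff: "ae_eq u u' \<Longrightarrow> ae_eq v v' \<Longrightarrow> ae_eq (\<lambda>t. u t - v t) (\<lambda>t. u' t - v' t)"
  unfolding ae_eq_def by (auto elim: eventually_elim2)

lemma ae_eq_scale: "ae_eq u u' \<Longrightarrow> ae_eq (\<lambda>t. a * u t) (\<lambda>t. a * u' t)"
  unfolding ae_eq_def by (auto elim: eventually_mono)

lemma ae_eq_sum:
  "(\<And>i. i \<in> I \<Longrightarrow> ae_eq (f i) (g i)) \<Longrightarrow> ae_eq (\<lambda>t. \<Sum>i\<in>I. f i t) (\<lambda>t. \<Sum>i\<in>I. g i t)"
  by (induction I rule: infinite_finite_induct) (auto intro: ae_eq_add)

text \<open>Zero vectors are allowed, so that the greedy choice can always be continued, even when no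
  direction of positive energy is left.\<close>

definition ortho :: "(nat \<Rightarrow> real \<Rightarrow> complex) \<Rightarrow> nat \<Rightarrow> bool" where
  "ortho e n \<longleftrightarrow> (\<forall>i<n. e i \<in> L2 \<and> l2norm (e i) \<in> {0, 1}) \<and>
     (\<forall>i<n. \<forall>j<n. i \<noteq> j \<longrightarrow> l2_inner (e i) (e j) = 0)"

text \<open>The usual projection onto the span. Normalizing factors are absent because the norms are
  0 or 1, and an \<open>e i\<close> of norm 0 has vanishing inner product with
  \<open>u\<close>.\<close>

definition ortho_proj :: "(nat \<Rightarrow> real \<Rightarrow> complex) \<Rightarrow> nat \<Rightarrow> l2op" where
  "ortho_proj e n u = (\<lambda>t. \<Sum>i<n. l2_inner u (e i) * e i t)"

lemma orthoD:
  assumes "ortho e n" "i < n"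
  shows "e i \<in> L2" "l2norm (e i) \<in> {0, 1}" "j < n \<Longrightarrow> i \<noteq> j \<Longrightarrow> l2_inner (e i) (e j) = 0"
  using assms by (auto simp: ortho_def)

text \<open>The transform \<open>a\<^sub>u\<close> pairs \<open>\<psi>\<^sub>p\<close> with
  \<open>u\<close> without conjugation, so Bessel's inequality has to be applied to the conjugate
  family. The same family spans the range of the left-hand projection in the nuclearity
  criterion.\<close>

lemma ortho_cnj:
  assumes "ortho e n" shows "ortho (\<lambda>i t. cnj (e i t)) n"
proof -
  have "l2_inner (\<lambda>t. cnj (e i t)) (\<lambda>t. cnj (e j t)) = cnj (l2_inner (e i) (e j))" for i j
    by (simp add: l2_inner_def flip: Bochner_Integration.integral_cnj)
  then show ?thesis using assms by (simp add: ortho_def L2_cnj l2norm_cnj)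
qed

lemma l2_inner_eq_0_if_l2norm_0:
  "u \<in> L2 \<Longrightarrow> v \<in> L2 \<Longrightarrow> l2norm v = 0 \<Longrightarrow> l2_inner u v = 0"
  using l2_Cauchy_Schwarz[of u v] by simp

lemma ortho_proj_L2: "ortho e n \<Longrightarrow> ortho_proj e n u \<in> L2"
  unfolding ortho_proj_def by (intro L2_sum L2_scale) (auto dest: orthoD)

lemma l2_inner_ortho_proj:
  assumes "ortho e n" "u \<in> L2" "j < n"
  shows "l2_inner (ortho_proj e n u) (e j) = l2_inner u (e j)"
proof -
  have "l2_inner (ortho_proj e n u) (e j) = (\<Sum>i<n. l2_inner u (e i) * l2_inner (e i) (e j))"
    using assms unfolding ortho_proj_def
    by (subst l2_inner_sum_left) (auto simp: l2_inner_scale_left intro!: L2_scale dest: orthoD)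
  also have "\<dots> = (\<Sum>i<n. if i = j then l2_inner u (e j) * l2_inner (e j) (e j) else 0)"
    using assms by (intro sum.cong refl) (auto dest: orthoD)
  also have "\<dots> = l2_inner u (e j) * l2_inner (e j) (e j)"
    using assms by simp
  \<comment> \<open>If \<open>e j\<close> has norm 1 the second factor is 1; if it has norm 0, both
    sides vanish by Cauchy-Schwarz.\<close>
  also have "\<dots> = l2_inner u (e j)"
    using orthoD(1,2)[OF assms(1,3)] l2_inner_eq_0_if_l2norm_0[OF assms(2), of "e j"]
    by (auto simp: l2_inner_self)
  finally show ?thesis .
qed

lemma l2_inner_ortho_proj_residual:
  assumes "ortho e n" "u \<in> L2" "j < n"
  shows "l2_inner (\<lambda>t. u t - ortho_proj e n u t) (e j) = 0"
  using assms
  by (simp add: l2_inner_diff_left ortho_proj_L2 orthoD l2_inner_ortho_proj)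

lemma l2_inner_ortho_proj_right:
  assumes "ortho e n" "v \<in> L2"
  shows "l2_inner v (ortho_proj e n u) = (\<Sum>i<n. cnj (l2_inner u (e i)) * l2_inner v (e i))"
  using assms unfolding ortho_proj_def
  by (subst l2_inner_sum_right) (auto simp: l2_inner_scale_right intro!: L2_scale dest: orthoD)

text \<open>The residual is orthogonal to every \<open>e i\<close>, hence to the projection, and the
  cross term in the square of the sum drops out. Dropping either summant on the right gives Bessel's
  inequality or the contractivity of the residual.\<close>

lemma ortho_proj_pythagoras:
  assumes "ortho e n" "u \<in> L2"
  shows "(l2norm u)\<^sup>2 = (l2norm (\<lambda>t. u t - ortho_proj e n u t))\<^sup>2 + (\<Sum>i<n. (cmod (l2_inner u (e i)))\<^sup>2)"
proof -
  let ?P = "ortho_proj e n u" and ?r = "\<lambda>t. u t - ortho_proj e n u t"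
  have P: "?P \<in> L2" and r: "?r \<in> L2"
    using assms by (auto intro: ortho_proj_L2 L2_diff)
  have "l2_inner ?r ?P = 0"
    by (simp add: l2_inner_ortho_proj_right[OF assms(1) r] l2_inner_ortho_proj_residual[OF assms])
  moreover have "l2_inner ?P ?P = of_real (\<Sum>i<n. (cmod (l2_inner u (e i)))\<^sup>2)"
    by (simp add: l2_inner_ortho_proj_right[OF assms(1) P] l2_inner_ortho_proj[OF assms]
        complex_norm_square mult.commute del: of_real_power)
  then have "(l2norm ?P)\<^sup>2 = (\<Sum>i<n. (cmod (l2_inner u (e i)))\<^sup>2)"
    by (simp add: l2_inner_self flip: of_real_power of_real_sum)
  ultimately show ?thesis
    using l2norm_add_power2[OF r P] by simp
qed

lemma Bessel_inequality:
  "ortho e n \<Longrightarrow> u \<in> L2 \<Longrightarrow> (\<Sum>i<n. (cmod (l2_inner u (e i)))\<^sup>2) \<le> (l2norm u)\<^sup>2"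
  using ortho_proj_pythagoras[of e n u] by simp

lemma l2norm_ortho_proj_residual_le:
  assumes "ortho e n" "u \<in> L2"
  shows "l2norm (\<lambda>t. u t - ortho_proj e n u t) \<le> l2norm u"
  using ortho_proj_pythagoras[OF assms] by (auto simp: sum_nonneg intro!: power2_le_imp_le[OF _ l2norm_nonneg])

section \<open>Bounded operators, rank and singular values\<close>

lemma bounded_opD:
  assumes "bounded_op T"
  shows bounded_op_L2: "u \<in> L2 \<Longrightarrow> T u \<in> L2"
    and bounded_op_ae: "u \<in> L2 \<Longrightarrow> v \<in> L2 \<Longrightarrow> ae_eq u v \<Longrightarrow> ae_eq (T u) (T v)"
    and bounded_op_lin: "u \<in> L2 \<Longrightarrow> v \<in> L2 \<Longrightarrow>
      ae_eq (T (\<lambda>t. a * u t + b * v t)) (\<lambda>t. a * T u t + b * T v t)"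
  using assms unfolding bounded_op_def by blast+

lemma bounded_op_bound:
  assumes "bounded_op T"
  obtains C where "C \<ge> 0" "\<And>u. u \<in> L2 \<Longrightarrow> l2norm (T u) \<le> C * l2norm u"
proof -
  from assms obtain C where C: "\<forall>u\<in>L2. l2norm (T u) \<le> C * l2norm u"
    unfolding bounded_op_def by blast
  show ?thesis
  proof
    fix u assume "u \<in> L2"
    with C have "l2norm (T u) \<le> C * l2norm u" by blast
    also have "\<dots> \<le> max C 0 * l2norm u" by (intro mult_right_mono) auto
    finally show "l2norm (T u) \<le> max C 0 * l2norm u" .
  qed simp
qed

lemma bounded_op_diff_arg:
  assumes "bounded_op T" "u \<in> L2" "v \<in> L2"
  shows "ae_eq (T (\<lambda>t. u t - v t)) (\<lambda>t. T u t - T v t)"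
  using bounded_op_lin[OF assms, of 1 "- 1"] by simp

lemma bounded_op_sum:
  assumes T: "bounded_op T" and e: "\<And>i. i \<in> I \<Longrightarrow> e i \<in> L2" and "finite I"
  shows "ae_eq (T (\<lambda>t. \<Sum>i\<in>I. c i * e i t)) (\<lambda>t. \<Sum>i\<in>I. c i * T (e i) t)"
  using \<open>finite I\<close> e
proof (induction I)
  case empty
  show ?case using bounded_op_lin[OF T L2_zero L2_zero, of 0 0] by simp
next
  case (insert i I)
  have s: "(\<lambda>t. \<Sum>i\<in>I. c i * e i t) \<in> L2"
    using insert by (intro L2_sum L2_scale) auto
  have "ae_eq (T (\<lambda>t. c i * e i t + 1 * (\<Sum>i\<in>I. c i * e i t)))
      (\<lambda>t. c i * T (e i) t + 1 * T (\<lambda>t. \<Sum>i\<in>I. c i * e i t) t)"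
    using insert by (intro bounded_op_lin[OF T _ s]) auto
  also have "ae_eq \<dots> (\<lambda>t. c i * T (e i) t + 1 * (\<Sum>i\<in>I. c i * T (e i) t))"
    using insert by (intro ae_eq_lin ae_eq_refl) auto
  finally show ?case using insert by simp
qed

lemma bounded_op_comp:
  assumes S: "bounded_op S" and T: "bounded_op T"
  shows "bounded_op (\<lambda>u. S (T u))"
  unfolding bounded_op_def
proof (intro conjI ballI allI impI)
  fix u v :: "real \<Rightarrow> complex" and a b :: complex assume u: "u \<in> L2" and v: "v \<in> L2"
  show "ae_eq (S (T (\<lambda>t. a * u t + b * v t))) (\<lambda>t. a * S (T u) t + b * S (T v) t)"
    by (rule ae_eq_trans[OF bounded_op_ae[OF S _ _ bounded_op_lin[OF T u v]] bounded_op_lin[OF S]])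
       (intro bounded_op_L2[OF T] L2_lin u v)+
next
  obtain C where "C \<ge> 0" and C: "\<And>u. u \<in> L2 \<Longrightarrow> l2norm (S u) \<le> C * l2norm u"
    using bounded_op_bound[OF S] by blast
  obtain D where D: "\<And>u. u \<in> L2 \<Longrightarrow> l2norm (T u) \<le> D * l2norm u"
    using bounded_op_bound[OF T] by blast
  have "l2norm (S (T u)) \<le> C * D * l2norm u" if "u \<in> L2" for u
    using order_trans[OF C[OF bounded_op_L2[OF T that]] mult_left_mono[OF D[OF that] \<open>C \<ge> 0\<close>]]
    by (simp add: mult.assoc)
  then show "\<exists>C. \<forall>u\<in>L2. l2norm (S (T u)) \<le> C * l2norm u" by blast
qed (use S T in \<open>auto intro: bounded_op_L2 bounded_op_ae\<close>)

lemma bounded_op_diff: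
  assumes S: "bounded_op S" and T: "bounded_op T"
  shows "bounded_op (\<lambda>u t. S u t - T u t)"
  unfolding bounded_op_def
proof (intro conjI ballI allI impI)
  fix u v :: "real \<Rightarrow> complex" and a b :: complex assume u: "u \<in> L2" and v: "v \<in> L2"
  show "ae_eq (\<lambda>t. S (\<lambda>t. a * u t + b * v t) t - T (\<lambda>t. a * u t + b * v t) t)
      (\<lambda>t. a * (S u t - T u t) + b * (S v t - T v t))"
    using ae_eq_diff[OF bounded_op_lin[OF S u v, of a b] bounded_op_lin[OF T u v, of a b]]
    by (simp add: algebra_simps)
next
  obtain C where C: "\<And>u. u \<in> L2 \<Longrightarrow> l2norm (S u) \<le> C * l2norm u"
    using bounded_op_bound[OF S] by blast
  obtain D where D: "\<And>u. u \<in> L2 \<Longrightarrow> l2norm (T u) \<le> D * l2norm u"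
    using bounded_op_bound[OF T] by blast
  have "l2norm (\<lambda>t. S u t - T u t) \<le> (C + D) * l2norm u" if "u \<in> L2" for u
    using order_trans[OF l2norm_diff_le[OF bounded_op_L2[OF S that] bounded_op_L2[OF T that]]
        add_mono[OF C[OF that] D[OF that]]]
    by (simp add: distrib_right)
  then show "\<exists>C. \<forall>u\<in>L2. l2norm (\<lambda>t. S u t - T u t) \<le> C * l2norm u" by blast
qed (use S T in \<open>auto intro: bounded_op_L2 bounded_op_ae L2_diff ae_eq_diff\<close>)

lemma bounded_op_residual:
  assumes e: "ortho e n"
  shows "bounded_op (\<lambda>u t. u t - ortho_proj e n u t)"
proof -
  have lin: "ortho_proj e n (\<lambda>t. a * u t + b * v t) = (\<lambda>t. a * ortho_proj e n u t + b * ortho_proj e n v t)"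
    if "u \<in> L2" "v \<in> L2" for u v a b
  proof
    fix t
    have "l2_inner (\<lambda>t. a * u t + b * v t) (e i) * e i t
        = a * (l2_inner u (e i) * e i t) + b * (l2_inner v (e i) * e i t)" if "i < n" for i
      using \<open>u \<in> L2\<close> \<open>v \<in> L2\<close> orthoD(1)[OF e that]
      by (simp add: l2_inner_add_left l2_inner_scale_left L2_scale distrib_right mult.assoc)
    then show "ortho_proj e n (\<lambda>t. a * u t + b * v t) t = a * ortho_proj e n u t + b * ortho_proj e n v t"
      unfolding ortho_proj_def sum_distrib_left by (simp flip: sum.distrib)
  qed
  have cong: "ortho_proj e n u = ortho_proj e n v" if "u \<in> L2" "v \<in> L2" "ae_eq u v" for u v
    unfolding ortho_proj_def
    using that e by (auto simp: fun_eq_iff intro!: sum.cong l2_inner_ae_cong_left dest: orthoD)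
  show ?thesis
    unfolding bounded_op_def
  proof (intro conjI ballI allI impI)
    fix u v :: "real \<Rightarrow> complex" and a b :: complex assume uv: "u \<in> L2" "v \<in> L2"
    show "ae_eq (\<lambda>t. a * u t + b * v t - ortho_proj e n (\<lambda>t. a * u t + b * v t) t)
        (\<lambda>t. a * (u t - ortho_proj e n u t) + b * (v t - ortho_proj e n v t))"
      unfolding lin[OF uv] by (rule ae_eq_pointwise) (simp add: algebra_simps)
    show "ae_eq (\<lambda>t. u t - ortho_proj e n u t) (\<lambda>t. v t - ortho_proj e n v t)" if "ae_eq u v"
      using cong[OF uv that] by (simp add: ae_eq_diff[OF that])
  next
    show "\<exists>C. \<forall>u\<in>L2. l2norm (\<lambda>t. u t - ortho_proj e n u t) \<le> C * l2norm u"
      using l2norm_ortho_proj_residual_le[OF e] by (intro exI[of _ 1]) simp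
  qed (intro L2_diff ortho_proj_L2[OF e])
qed

section \<open>Operator norm and singular values\<close>

lemma op_norm_le:
  assumes "\<And>u. u \<in> L2 \<Longrightarrow> l2norm u \<le> 1 \<Longrightarrow> l2norm (T u) \<le> c"
  shows "op_norm T \<le> c"
  unfolding op_norm_def
proof (rule cSUP_least)
  have "(\<lambda>t. 0) \<in> {u \<in> L2. l2norm u \<le> 1}" by (simp add: L2_zero)
  then show "{u \<in> L2. l2norm u \<le> 1} \<noteq> {}" by blast
qed (use assms in simp)

lemma op_norm_upper:
  assumes "bounded_op T" "u \<in> L2" "l2norm u \<le> 1"
  shows "l2norm (T u) \<le> op_norm T"
proof -
  obtain C where "C \<ge> 0" and C: "\<And>u. u \<in> L2 \<Longrightarrow> l2norm (T u) \<le> C * l2norm u"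
    using bounded_op_bound[OF assms(1)] by blast
  have "l2norm (T u) \<le> C" if "u \<in> L2" "l2norm u \<le> 1" for u
    using C[OF that(1)] mult_left_mono[OF that(2) \<open>C \<ge> 0\<close>] by simp
  then have "bdd_above ((\<lambda>u. l2norm (T u)) ` {u \<in> L2. l2norm u \<le> 1})"
    by (auto intro!: bdd_aboveI2[where M = C])
  then show ?thesis
    unfolding op_norm_def by (rule cSUP_upper[rotated]) (use assms in simp)
qed

lemma op_norm_nonneg: "bounded_op T \<Longrightarrow> 0 \<le> op_norm T"
  using order_trans[OF l2norm_nonneg op_norm_upper[OF _ L2_zero]] by simp

lemma singular_value_le:
  assumes "bounded_op G" "bounded_op T" "rank_less T k"
  shows "singular_value G k \<le> op_norm (\<lambda>u t. G u t - T u t)"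
proof -
  have "bdd_below ((\<lambda>T. op_norm (\<lambda>u t. G u t - T u t)) ` {T. bounded_op T \<and> rank_less T k})"
    using assms(1) by (auto intro!: bdd_belowI2[where m = 0] op_norm_nonneg bounded_op_diff)
  then show ?thesis
    unfolding singular_value_def by (rule cINF_lower) (use assms in simp)
qed

lemma rank_less_mono: "rank_less T k \<Longrightarrow> k \<le> l \<Longrightarrow> rank_less T l"
  unfolding rank_less_def by (meson order_less_le_trans)

lemma bounded_op_zero: "bounded_op (\<lambda>u t. 0)"
  by (auto simp: bounded_op_def L2_zero intro: exI[of _ 0])

text \<open>The zero operator is a candidate as soon as the index is at least 1, so the infimum
  defining \<open>singular_value\<close> is a genuine one.\<close>

lemma finite_rank_ops_nonempty: "{T. bounded_op T \<and> rank_less T (Suc k)} \<noteq> {}"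
proof -
  have "rank_less (\<lambda>u t. 0) (Suc k)"
    unfolding rank_less_def by (intro exI[of _ "{}"]) simp
  with bounded_op_zero show ?thesis by blast
qed

lemma singular_value_nonneg: "bounded_op G \<Longrightarrow> 0 \<le> singular_value G (Suc k)"
  unfolding singular_value_def
  by (rule cINF_greatest[OF finite_rank_ops_nonempty]) (auto intro: op_norm_nonneg bounded_op_diff)

lemma singular_value_approx:
  assumes "bounded_op G" "\<epsilon> > 0"
  obtains T where "bounded_op T" "rank_less T (Suc k)"
    "op_norm (\<lambda>u t. G u t - T u t) < singular_value G (Suc k) + \<epsilon>"
proof -
  have "\<exists>y\<in>(\<lambda>T. op_norm (\<lambda>u t. G u t - T u t)) ` {T. bounded_op T \<and> rank_less T (Suc k)}.
      y < singular_value G (Suc k) + \<epsilon>"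
    unfolding singular_value_def
    by (rule cInf_lessD) (use assms(2) finite_rank_ops_nonempty in simp_all)
  then show ?thesis using that by auto
qed

text \<open>Gaussian elimination, carried out modulo a.e. equality.\<close>

lemma span_by_own_elements:
  assumes "\<And>x y a b. x \<in> S \<Longrightarrow> y \<in> S \<Longrightarrow> \<exists>z\<in>S. ae_eq z (\<lambda>t. a * x t + b * y t)"
    and "\<And>x. x \<in> S \<Longrightarrow> \<exists>c. ae_eq x (\<lambda>t. \<Sum>i<n. c i * f i t)"
  shows "\<exists>B\<subseteq>S. finite B \<and> card B \<le> n \<and> (\<forall>x\<in>S. \<exists>c. ae_eq x (\<lambda>t. \<Sum>b\<in>B. c b * b t))"
  using assms
proof (induction n arbitrary: S)
  case 0
  then show ?case by (intro exI[of _ "{}"]) simp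
next
  case (Suc n)
  \<comment> \<open>The elements whose expansion can avoid \<open>f n\<close>; the induction
    hypothesis applies to them.\<close>
  define S' where "S' = {x \<in> S. \<exists>c. ae_eq x (\<lambda>t. \<Sum>i<n. c i * f i t)}"
  have closed: "\<exists>z\<in>S'. ae_eq z (\<lambda>t. a * x t + b * y t)" if "x \<in> S'" "y \<in> S'" for x y a b
  proof -
    obtain c d where c: "ae_eq x (\<lambda>t. \<Sum>i<n. c i * f i t)" and d: "ae_eq y (\<lambda>t. \<Sum>i<n. d i * f i t)"
      using \<open>x \<in> S'\<close> \<open>y \<in> S'\<close> unfolding S'_def by blast
    obtain z where z: "z \<in> S" "ae_eq z (\<lambda>t. a * x t + b * y t)"
      using Suc.prems(1) \<open>x \<in> S'\<close> \<open>y \<in> S'\<close> unfolding S'_def by blast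
    have "ae_eq z (\<lambda>t. a * (\<Sum>i<n. c i * f i t) + b * (\<Sum>i<n. d i * f i t))"
      by (rule ae_eq_trans[OF z(2) ae_eq_lin[OF c d]])
    also have "(\<lambda>t. a * (\<Sum>i<n. c i * f i t) + b * (\<Sum>i<n. d i * f i t))
        = (\<lambda>t. \<Sum>i<n. (a * c i + b * d i) * f i t)"
      by (simp add: sum_distrib_left algebra_simps sum.distrib)
    finally have "z \<in> S'" using z(1) unfolding S'_def
      by (auto intro: exI[of _ "\<lambda>i. a * c i + b * d i"])
    with z(2) show ?thesis by blast
  qed
  obtain B where B: "B \<subseteq> S'" "finite B" "card B \<le> n"
    and span: "\<forall>x\<in>S'. \<exists>c. ae_eq x (\<lambda>t. \<Sum>b\<in>B. c b * b t)"
    using Suc.IH[of S', OF closed] unfolding S'_def by blast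
  show ?case
  proof (cases "S' = S")
    case True
    with B span show ?thesis by (intro exI[of _ B]) auto
  next
    case False
    \<comment> \<open>An element that cannot avoid \<open>f n\<close> has a nonzero coefficient
      there, so it can replace \<open>f n\<close> as a spanning element.\<close>
    then obtain x0 where x0: "x0 \<in> S" "x0 \<notin> S'" unfolding S'_def by blast
    obtain c where c: "ae_eq x0 (\<lambda>t. \<Sum>i<Suc n. c i * f i t)"
      using Suc.prems(2)[OF x0(1)] by blast
    have cn: "c n \<noteq> 0"
    proof
      assume "c n = 0"
      with c have "ae_eq x0 (\<lambda>t. \<Sum>i<n. c i * f i t)" by simp
      with x0 show False unfolding S'_def by blast
    qed
    have "\<exists>c'. ae_eq x (\<lambda>t. \<Sum>b\<in>insert x0 B. c' b * b t)" if "x \<in> S" for x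
    proof -
      obtain d where d: "ae_eq x (\<lambda>t. \<Sum>i<Suc n. d i * f i t)"
        using Suc.prems(2)[OF \<open>x \<in> S\<close>] by blast
      \<comment> \<open>Chosen so that \<open>f n\<close> cancels in \<open>x - r * x0\<close>,
        which therefore lies in \<open>S'\<close> up to a.e. equality.\<close>
      define r where "r = d n / c n"
      obtain z where z: "z \<in> S" "ae_eq z (\<lambda>t. 1 * x t + (- r) * x0 t)"
        using Suc.prems(1)[OF \<open>x \<in> S\<close> x0(1)] by blast
      have "ae_eq z (\<lambda>t. 1 * (\<Sum>i<Suc n. d i * f i t) + (- r) * (\<Sum>i<Suc n. c i * f i t))"
        by (rule ae_eq_trans[OF z(2) ae_eq_lin[OF d c]])
      also have "(\<lambda>t. 1 * (\<Sum>i<Suc n. d i * f i t) + (- r) * (\<Sum>i<Suc n. c i * f i t))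
          = (\<lambda>t. \<Sum>i<n. (d i - r * c i) * f i t)"
      proof
        fix t
        have "r * c n = d n" using cn by (simp add: r_def)
        then have "1 * (\<Sum>i<Suc n. d i * f i t) + (- r) * (\<Sum>i<Suc n. c i * f i t)
            = (\<Sum>i<n. d i * f i t) - r * (\<Sum>i<n. c i * f i t)"
          by (simp add: algebra_simps mult.assoc[symmetric])
        also have "\<dots> = (\<Sum>i<n. (d i - r * c i) * f i t)"
          by (simp add: sum_distrib_left sum_subtractf left_diff_distrib mult.assoc)
        finally show "1 * (\<Sum>i<Suc n. d i * f i t) + (- r) * (\<Sum>i<Suc n. c i * f i t)
            = (\<Sum>i<n. (d i - r * c i) * f i t)" .
      qed
      finally have "z \<in> S'" using z(1) unfolding S'_def
        by (auto intro: exI[of _ "\<lambda>i. d i - r * c i"])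
      then obtain g where g: "ae_eq z (\<lambda>t. \<Sum>b\<in>B. g b * b t)" using span by blast
      have "ae_eq (\<lambda>t. 1 * z t + r * x0 t) (\<lambda>t. 1 * (1 * x t + (- r) * x0 t) + r * x0 t)"
        by (rule ae_eq_lin[OF z(2) ae_eq_refl])
      then have "ae_eq x (\<lambda>t. 1 * z t + r * x0 t)" by (simp add: ae_eq_sym)
      also have "ae_eq (\<lambda>t. 1 * z t + r * x0 t) (\<lambda>t. 1 * (\<Sum>b\<in>B. g b * b t) + r * x0 t)"
        by (rule ae_eq_lin[OF g ae_eq_refl])
      also have "(\<lambda>t. 1 * (\<Sum>b\<in>B. g b * b t) + r * x0 t)
          = (\<lambda>t. \<Sum>b\<in>insert x0 B. (g(x0 := r)) b * b t)"
      proof -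
        have "x0 \<notin> B" using B x0 by blast
        then have "(\<Sum>b\<in>B. (g(x0 := r)) b * b t) = (\<Sum>b\<in>B. g b * b t)" for t
          by (intro sum.cong) auto
        then show ?thesis using \<open>x0 \<notin> B\<close> B by (simp add: add.commute)
      qed
      finally show ?thesis by blast
    qed
    moreover have "insert x0 B \<subseteq> S" "finite (insert x0 B)" "card (insert x0 B) \<le> Suc n"
      using B x0 S'_def by (auto simp: card_insert_if)
    ultimately show ?thesis by blast
  qed
qed

text \<open>\<open>rank_less\<close> wants spanning elements from the range of \<open>T\<close>
  itself, whereas rank bounds arise from arbitrary spanning functions. Linearity of \<open>T\<close>
  makes its range closed under combinations modulo a.e. equality, so the elimination above
  applies.\<close>

lemma rank_less_if_spanned:
  assumes T: "bounded_op T" and "\<And>u. u \<in> L2 \<Longrightarrow> \<exists>c. ae_eq (T u) (\<lambda>t. \<Sum>i<n. c i * f i t)"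
  shows "rank_less T (Suc n)"
proof -
  have "\<exists>z\<in>T ` L2. ae_eq z (\<lambda>t. a * x t + b * y t)" if "x \<in> T ` L2" "y \<in> T ` L2" for x y a b
    using that bounded_op_lin[OF T] L2_lin by blast
  then have "\<exists>B\<subseteq>T ` L2. finite B \<and> card B \<le> n \<and> (\<forall>x\<in>T ` L2. \<exists>c. ae_eq x (\<lambda>t. \<Sum>b\<in>B. c b * b t))"
    using assms(2) by (intro span_by_own_elements) auto
  then show ?thesis unfolding rank_less_def by (auto simp: less_Suc_eq_le)
qed

section \<open>A nuclearity criterion\<close>

text \<open>The greedy argument for an abstract \<open>Q\<close> in the role of
  \<open>\<parallel>a\<^sub>u\<parallel>\<^sup>2\<close>. \<open>Q_le\<close> keeps the suprema
  finite, \<open>form_le\<close> turns small \<open>Q\<close> on an orthogonal complement into a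
  small operator norm there, and \<open>Q_sum\<close> makes the resulting bounds summable.\<close>

lemma nuclear_if_quadratic_bound:
  fixes Q :: "(real \<Rightarrow> complex) \<Rightarrow> real"
  assumes G: "bounded_op G"
    and Q_nonneg: "\<And>u. u \<in> L2 \<Longrightarrow> 0 \<le> Q u"
    and Q_scale: "\<And>u a. u \<in> L2 \<Longrightarrow> Q (\<lambda>t. a * u t) = (cmod a)\<^sup>2 * Q u"
    and Q_le: "\<And>u. u \<in> L2 \<Longrightarrow> Q u \<le> C * (l2norm u)\<^sup>2"
    and form_le: "\<And>u v. u \<in> L2 \<Longrightarrow> v \<in> L2 \<Longrightarrow>
      cmod (l2_inner (G u) v) \<le> sqrt (Q u) * sqrt (Q (\<lambda>t. cnj (v t)))"
    and Q_sum: "\<And>e n. ortho e n \<Longrightarrow> (\<Sum>i<n. Q (e i)) \<le> H"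
  shows "nuclear G"
proof -
  define perp where "perp e k u \<longleftrightarrow> u \<in> L2 \<and> (\<forall>i<k. l2_inner u (e i) = 0)"
    for e :: "nat \<Rightarrow> real \<Rightarrow> complex" and k :: nat and u
  \<comment> \<open>One greedy choice. The factor 2 is the price for a supremum that may not be
    attained.\<close>
  define step where "step e k f \<longleftrightarrow> perp e k f \<and> l2norm f \<in> {0, 1} \<and>
      (\<forall>u. perp e k u \<longrightarrow> Q u \<le> 2 * Q f * (l2norm u)\<^sup>2)" for e k f
  have step_ex: "\<exists>f. step e k f" for e k
  proof (cases "\<exists>u. perp e k u \<and> Q u > 0")
    case False
    have "Q u \<le> 2 * Q (\<lambda>t. 0) * (l2norm u)\<^sup>2" if "perp e k u" for u
    proof -
      have "Q u \<le> 0" using False that by (auto simp: not_less)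
      moreover have "0 \<le> 2 * Q (\<lambda>t. 0) * (l2norm u)\<^sup>2" using Q_nonneg[OF L2_zero] by simp
      ultimately show ?thesis by linarith
    qed
    then have "step e k (\<lambda>t. 0)"
      by (simp add: step_def perp_def L2_zero l2_inner_zero_left)
    then show ?thesis by blast
  next
    case True
    define S where "S = {Q u |u. perp e k u \<and> l2norm u = 1}"
    have normalize: "\<exists>f. perp e k f \<and> l2norm f = 1 \<and> Q u = Q f * (l2norm u)\<^sup>2"
      if "perp e k u" "Q u > 0" for u
    proof -
      \<comment> \<open>By \<open>Q_le\<close> a vector of norm 0 has no positive energy, so
        \<open>u\<close> can be normalized.\<close>
      have "l2norm u \<noteq> 0" using Q_le[of u] that by (auto simp: perp_def)
      then have "l2norm u > 0" using l2norm_nonneg[of u] by linarith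
      define c :: complex where "c = of_real (1 / l2norm u)"
      have "cmod c * l2norm u = 1" using \<open>l2norm u > 0\<close> by (simp add: c_def norm_divide)
      then have "Q u = (cmod c)\<^sup>2 * Q u * (l2norm u)\<^sup>2"
        by (metis mult.assoc mult.commute mult.right_neutral power_mult_distrib power_one)
      with \<open>cmod c * l2norm u = 1\<close> \<open>perp e k u\<close> show ?thesis
        by (intro exI[of _ "\<lambda>t. c * u t"])
          (auto simp: perp_def L2_scale l2norm_scale l2_inner_scale_left Q_scale)
    qed
    obtain u where "perp e k u" "Q u > 0" using True by blast
    then obtain f where f: "perp e k f" "l2norm f = 1" "Q f > 0"
      using normalize[of u] by (metis mult_nonpos_nonneg not_less zero_le_power2)
    have "bdd_above S"
      using Q_le by (intro bdd_aboveI[of _ C]) (force simp: S_def perp_def)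
    have "Q f \<in> S" using f unfolding S_def by blast
    then have "Q f \<le> Sup S" using \<open>bdd_above S\<close> by (rule cSup_upper)
    \<comment> \<open>\<open>Sup S\<close> is positive because \<open>Q f\<close> is, so some value
      of \<open>Q\<close> lies above half of it.\<close>
    then have "Sup S / 2 < Sup S" using f by simp
    then obtain y where "y \<in> S" "Sup S / 2 < y"
      using less_cSupE[of "Sup S / 2" S] \<open>Q f \<in> S\<close> by blast
    then obtain g where g: "perp e k g" "l2norm g = 1" "Sup S < 2 * Q g"
      unfolding S_def by force
    have "Q u \<le> 2 * Q g * (l2norm u)\<^sup>2" if u: "perp e k u" for u
    proof (cases "Q u > 0")
      case True
      obtain v where v: "perp e k v" "l2norm v = 1" "Q u = Q v * (l2norm u)\<^sup>2"
        using normalize[OF u True] by blast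
      have "Q v \<in> S" using v unfolding S_def by blast
      then have "Q v \<le> 2 * Q g" using cSup_upper[OF _ \<open>bdd_above S\<close>, of "Q v"] g by linarith
      then show ?thesis unfolding v(3) by (intro mult_right_mono) auto
    next
      case False
      moreover have "0 \<le> 2 * Q g * (l2norm u)\<^sup>2" using Q_nonneg[of g] g by (auto simp: perp_def)
      ultimately show ?thesis by linarith
    qed
    then have "step e k g" using g by (simp add: step_def)
    then show ?thesis by blast
  qed
  obtain e where e: "\<And>k. step e k (e k)"
  proof -
    \<comment> \<open>Each choice depends on all earlier ones, hence dependent choice along the
      well-order of the naturals; its side condition is that \<open>step e k\<close> looks only at
      \<open>e\<close> below \<open>k\<close>.\<close>
    have "\<exists>e. \<forall>k. step e k (e k)"
    proof (rule dependent_wellorder_choice)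
      fix r and f g :: "nat \<Rightarrow> real \<Rightarrow> complex" and k :: nat
      assume "\<And>y. y < k \<Longrightarrow> f y = g y"
      then have "perp f k = perp g k" by (intro ext) (simp add: perp_def)
      then show "step f k r = step g k r" by (simp add: step_def)
    qed (rule step_ex)
    with that show ?thesis by blast
  qed
  have e_L2: "e k \<in> L2" and e_norm: "l2norm (e k) \<in> {0, 1}" for k
    using e[of k] by (auto simp: step_def perp_def)
  have e_perp: "l2_inner (e i) (e j) = 0" if "j < i" for i j
    using e[of i] that by (simp add: step_def perp_def)
  have e_perp': "l2_inner (e i) (e j) = 0" if "i \<noteq> j" for i j
  proof (cases "j < i")
    case False
    then have "l2_inner (e j) (e i) = 0" using that by (intro e_perp) auto
    then show ?thesis by (subst l2_inner_cnj) simp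
  qed (rule e_perp)
  have ortho: "ortho e k" for k
    using e_L2 e_norm e_perp' by (auto simp: ortho_def)
  have greedy: "Q u \<le> 2 * Q (e k) * (l2norm u)\<^sup>2" if "u \<in> L2" "\<And>i. i < k \<Longrightarrow> l2_inner u (e i) = 0" for u k
    using e[of k] that by (simp add: step_def perp_def)
  have sv: "singular_value G (Suc n) \<le> 2 * Q (e k)" if "2 * k \<le> n" for n k
  proof -
    \<comment> \<open>\<open>form_le\<close> involves \<open>Q\<close> of the conjugate of
      \<open>v\<close>. For the greedy bound to apply, that conjugate must be orthogonal to the
      \<open>e i\<close>, that is, \<open>v\<close> must be orthogonal to the conjugates of the
      \<open>e i\<close>.\<close>
    define ec where "ec = (\<lambda>i t. cnj (e i t))"
    have ec: "ortho ec k" unfolding ec_def by (rule ortho_cnj[OF ortho])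
    define P1 where "P1 u = (\<lambda>t. u t - ortho_proj e k u t)" for u
    define Q1 where "Q1 u = (\<lambda>t. u t - ortho_proj ec k u t)" for u
    define R where "R u = Q1 (G (P1 u))" for u
    define T where "T u = (\<lambda>t. G u t - R u t)" for u
    have P1: "bounded_op P1" and Q1: "bounded_op Q1"
      unfolding P1_def[abs_def] Q1_def[abs_def] by (intro bounded_op_residual ortho ec)+
    have R: "bounded_op R"
      unfolding R_def[abs_def] by (intro bounded_op_comp[OF Q1] bounded_op_comp[OF G] P1)
    have T: "bounded_op T"
      unfolding T_def[abs_def] by (intro bounded_op_diff G R)
    \<comment> \<open>With \<open>P = ortho_proj e k\<close> and
      \<open>P' = ortho_proj ec k\<close>, \<open>T u\<close> equals
      \<open>G (P u) + P' (G (P1 u))\<close> a.e.; the first term is spanned by the \<open>k\<close>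
      images \<open>G (e i)\<close>, the second by the \<open>k\<close> functions
      \<open>ec i\<close>.\<close>
    define f where "f i = (if i < k then G (e i) else ec (i - k))" for i
    have "rank_less T (Suc (2 * k))"
    proof (rule rank_less_if_spanned[OF T])
      fix u assume u: "u \<in> L2"
      define g where "g = G (P1 u)"
      define c where "c i = (if i < k then l2_inner u (e i) else l2_inner g (ec (i - k)))" for i
      have Pu: "ortho_proj e k u \<in> L2" by (rule ortho_proj_L2[OF ortho])
      have "ae_eq (T u) (\<lambda>t. G u t - (g t - ortho_proj ec k g t))"
        by (simp add: T_def R_def Q1_def g_def)
      also have "ae_eq g (\<lambda>t. G u t - G (ortho_proj e k u) t)"
        unfolding g_def P1_def by (rule bounded_op_diff_arg[OF G u Pu])
      then have "ae_eq (\<lambda>t. G u t - (g t - ortho_proj ec k g t))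
          (\<lambda>t. G u t - ((G u t - G (ortho_proj e k u) t) - ortho_proj ec k g t))"
        by (intro ae_eq_diff ae_eq_refl)
      also have "(\<lambda>t. G u t - ((G u t - G (ortho_proj e k u) t) - ortho_proj ec k g t))
          = (\<lambda>t. G (ortho_proj e k u) t + ortho_proj ec k g t)"
        by simp
      also have "ae_eq (G (ortho_proj e k u)) (\<lambda>t. \<Sum>i<k. l2_inner u (e i) * G (e i) t)"
        unfolding ortho_proj_def by (rule bounded_op_sum[OF G]) (auto intro: e_L2)
      then have "ae_eq (\<lambda>t. G (ortho_proj e k u) t + ortho_proj ec k g t)
          (\<lambda>t. (\<Sum>i<k. l2_inner u (e i) * G (e i) t) + ortho_proj ec k g t)"
        by (intro ae_eq_add ae_eq_refl)
      also have "(\<lambda>t. (\<Sum>i<k. l2_inner u (e i) * G (e i) t) + ortho_proj ec k g t)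
          = (\<lambda>t. \<Sum>i<2 * k. c i * f i t)"
      proof
        fix t
        have "(\<Sum>i<2 * k. c i * f i t) = (\<Sum>i<k. c i * f i t) + (\<Sum>i=k..<k + k. c i * f i t)"
          by (simp add: atLeast0LessThan[symmetric] mult_2 sum.atLeastLessThan_concat)
        also have "(\<Sum>i=k..<k + k. c i * f i t) = (\<Sum>i<k. c (i + k) * f (i + k) t)"
          using sum.shift_bounds_nat_ivl[of "\<lambda>i. c i * f i t" 0 k k] by (simp add: atLeast0LessThan)
        finally show "(\<Sum>i<k. l2_inner u (e i) * G (e i) t) + ortho_proj ec k g t = (\<Sum>i<2 * k. c i * f i t)"
          by (simp add: c_def f_def ortho_proj_def)
      qed
      finally show "\<exists>c. ae_eq (T u) (\<lambda>t. \<Sum>i<2 * k. c i * f i t)"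
        by blast
    qed
    then have "rank_less T (Suc n)" by (rule rank_less_mono) (use that in simp)
    then have "singular_value G (Suc n) \<le> op_norm (\<lambda>u t. G u t - T u t)"
      by (rule singular_value_le[OF G T])
    also have "(\<lambda>u t. G u t - T u t) = R" by (simp add: T_def fun_eq_iff)
    also have "op_norm R \<le> 2 * Q (e k)"
    proof (rule op_norm_le)
      fix u assume u: "u \<in> L2" "l2norm u \<le> 1"
      define f where "f = R u"
      define g where "g = G (P1 u)"
      have P1u: "P1 u \<in> L2" and g: "g \<in> L2" and f: "f \<in> L2"
        unfolding g_def f_def by (intro bounded_op_L2[OF P1] bounded_op_L2[OF G] bounded_op_L2[OF R] u)+
      have f_eq: "f = (\<lambda>t. g t - ortho_proj ec k g t)"
        by (simp add: f_def R_def g_def Q1_def)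
      have f_perp: "l2_inner f (ec i) = 0" if "i < k" for i
        unfolding f_eq by (rule l2_inner_ortho_proj_residual[OF ec g that])
      \<comment> \<open>\<open>f\<close> is \<open>g\<close> minus its projection and is orthogonal
        to that projection, so the squared norm of \<open>f\<close> is the form value of
        \<open>g = G (P1 u)\<close> against \<open>f\<close>, where \<open>form_le\<close>
        applies.\<close>
      have "l2_inner f f = l2_inner g f - l2_inner (ortho_proj ec k g) f"
        by (subst (1) f_eq) (rule l2_inner_diff_left[OF g ortho_proj_L2[OF ec] f])
      also have "l2_inner (ortho_proj ec k g) f = 0"
        by (subst l2_inner_cnj) (simp add: l2_inner_ortho_proj_right[OF ec f] f_perp)
      finally have "cmod (l2_inner f f) = cmod (l2_inner g f)" by simp
      then have "(l2norm f)\<^sup>2 = cmod (l2_inner g f)"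
        unfolding l2_inner_self norm_of_real by simp
      also have "\<dots> \<le> sqrt (Q (P1 u)) * sqrt (Q (\<lambda>t. cnj (f t)))"
        unfolding g_def by (rule form_le[OF P1u f])
      also have "\<dots> \<le> sqrt (2 * Q (e k) * (l2norm (P1 u))\<^sup>2) * sqrt (2 * Q (e k) * (l2norm f)\<^sup>2)"
      proof (intro mult_mono real_sqrt_le_mono)
        show "Q (P1 u) \<le> 2 * Q (e k) * (l2norm (P1 u))\<^sup>2"
          by (rule greedy[OF P1u]) (simp add: P1_def l2_inner_ortho_proj_residual[OF ortho u(1)])
        have "l2_inner (\<lambda>t. cnj (f t)) (e i) = 0" if "i < k" for i
        proof -
          have "l2_inner (\<lambda>t. cnj (f t)) (e i) = cnj (l2_inner f (ec i))"
            by (simp add: l2_inner_def ec_def flip: Bochner_Integration.integral_cnj)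
          then show ?thesis by (simp add: f_perp[OF that])
        qed
        then show "Q (\<lambda>t. cnj (f t)) \<le> 2 * Q (e k) * (l2norm f)\<^sup>2"
          using greedy[OF L2_cnj[OF f], of k] by (simp add: l2norm_cnj)
      qed (auto simp: Q_nonneg P1u L2_cnj f e_L2)
      also have "\<dots> = sqrt (((2 * Q (e k) * l2norm (P1 u)) * l2norm f)\<^sup>2)"
        unfolding real_sqrt_mult[symmetric] by (simp add: power2_eq_square mult_ac)
      also have "\<dots> = (2 * Q (e k) * l2norm (P1 u)) * l2norm f"
        using Q_nonneg[OF e_L2[of k]] by (intro real_sqrt_unique) auto
      finally have "l2norm f * l2norm f \<le> (2 * Q (e k) * l2norm (P1 u)) * l2norm f"
        by (simp add: power2_eq_square)
      then have "l2norm f \<le> 2 * Q (e k) * l2norm (P1 u)"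
        using l2norm_nonneg[of f] l2norm_nonneg[of "P1 u"] Q_nonneg[OF e_L2[of k]]
        by (cases "l2norm f = 0") (auto dest!: mult_right_le_imp_le)
      also have "\<dots> \<le> 2 * Q (e k) * 1"
        using order_trans[OF l2norm_ortho_proj_residual_le[OF ortho u(1)] u(2)] Q_nonneg[OF e_L2[of k]]
        unfolding P1_def by (intro mult_left_mono) auto
      finally show "l2norm (R u) \<le> 2 * Q (e k)" by (simp add: f_def)
    qed
    finally show ?thesis .
  qed
  have "summable (\<lambda>k. singular_value G (Suc k))"
  proof (rule summableI_nonneg_bounded)
    fix n
    have "(\<Sum>i<n. singular_value G (Suc i)) \<le> (\<Sum>i<2 * n. singular_value G (Suc i))"
      by (rule sum_mono2) (auto simp: singular_value_nonneg[OF G])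
    \<comment> \<open>Rank at most \<open>2 * k\<close> controls the singular values with indices
      \<open>2 * k + 1\<close> and \<open>2 * k + 2\<close> by the same \<open>2 * Q (e k)\<close>;
      grouping them in pairs gives the total bound \<open>4 * H\<close>.\<close>
    also have "\<dots> = (\<Sum>k<n. singular_value G (Suc (2 * k)) + singular_value G (Suc (2 * k + 1)))"
      by (induction n) (auto simp: algebra_simps)
    also have "\<dots> \<le> (\<Sum>k<n. 2 * Q (e k) + 2 * Q (e k))"
      by (intro sum_mono add_mono sv) auto
    also have "\<dots> = 4 * (\<Sum>k<n. Q (e k))" by (simp add: sum_distrib_left)
    also have "\<dots> \<le> 4 * H" using Q_sum[OF ortho] by simp
    finally show "(\<Sum>i<n. singular_value G (Suc i)) \<le> 4 * H" .
  qed (rule singular_value_nonneg[OF G])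
  with G show ?thesis by (simp add: nuclear_def)
qed

section \<open>Traces of nuclear operators\<close>

text \<open>Elimination of one equation at a time: an equation with a nonzero coefficient at
  \<open>j0\<close> is solved for \<open>x j0\<close> and discarded together with that unknown,
  which preserves the inequality between the cardinalities.\<close>

lemma underdetermined_system:
  fixes a :: "'i \<Rightarrow> 'j \<Rightarrow> complex"
  assumes "finite I" "finite J" "card I < card J"
  shows "\<exists>x. (\<exists>j\<in>J. x j \<noteq> 0) \<and> (\<forall>i\<in>I. (\<Sum>j\<in>J. a i j * x j) = 0)"
  using assms
proof (induction I arbitrary: J a)
  case empty
  then have "J \<noteq> {}" by auto
  then show ?case by (intro exI[of _ "\<lambda>_. 1"]) auto
next
  case (insert i I)
  show ?case
  proof (cases "\<forall>j\<in>J. a i j = 0")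
    case True
    have "card I < card J" using insert by simp
    with insert obtain x where "\<exists>j\<in>J. x j \<noteq> 0" "\<forall>i\<in>I. (\<Sum>j\<in>J. a i j * x j) = 0" by blast
    with True show ?thesis by auto
  next
    case False
    then obtain j0 where j0: "j0 \<in> J" "a i j0 \<noteq> 0" by blast
    define J' where "J' = J - {j0}"
    \<comment> \<open>The coefficients of the other equations after substituting the solution for
      the unknown \<open>j0\<close>.\<close>
    define b where "b k j = a k j - a k j0 * (a i j / a i j0)" for k j
    have fin: "finite J'" and card: "card I < card J'"
      using insert j0 by (simp_all add: J'_def card_Diff_singleton)
    obtain y where y: "\<exists>j\<in>J'. y j \<noteq> 0" "\<forall>k\<in>I. (\<Sum>j\<in>J'. b k j * y j) = 0"
      using insert.IH[OF fin card] by blast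
    define x where "x = y(j0 := - (\<Sum>j\<in>J'. a i j * y j) / a i j0)"
    have sum_x: "(\<Sum>j\<in>J. a k j * x j) = a k j0 * x j0 + (\<Sum>j\<in>J'. a k j * y j)" for k
    proof -
      have "(\<Sum>j\<in>J'. a k j * x j) = (\<Sum>j\<in>J'. a k j * y j)"
        by (intro sum.cong) (auto simp: x_def J'_def)
      then show ?thesis
        using insert.prems(1) j0(1) by (simp add: sum.remove[of J j0] J'_def)
    qed
    have "(\<Sum>j\<in>J. a k j * x j) = 0" if "k \<in> I" for k
    proof -
      have "0 = (\<Sum>j\<in>J'. b k j * y j)"
        using y(2) that by simp
      also have "\<dots> = (\<Sum>j\<in>J'. a k j * y j - a k j0 / a i j0 * (a i j * y j))"
        by (intro sum.cong refl) (simp add: b_def left_diff_distrib)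
      also have "\<dots> = (\<Sum>j\<in>J'. a k j * y j) - a k j0 / a i j0 * (\<Sum>j\<in>J'. a i j * y j)"
        by (simp add: sum_subtractf sum_distrib_left)
      finally show ?thesis unfolding sum_x by (simp add: x_def)
    qed
    moreover have "(\<Sum>j\<in>J. a i j * x j) = 0"
      using j0(2) unfolding sum_x by (simp add: x_def)
    moreover have "\<exists>j\<in>J. x j \<noteq> 0"
      using y(1) by (auto simp: x_def J'_def)
    ultimately show ?thesis by auto
  qed
qed

text \<open>The trace over a finite orthonormal family depends only on its span, so the basis may be
  adapted to near-optimal finite-rank approximations. The constant, uniform over all families, is
  the sum of the singular values plus the sum of the errors \<open>(1/2) ^ k\<close>.\<close>

lemma nuclear_trace_bound:
  assumes "nuclear G"
  obtains C where "\<And>J (e :: 'j \<Rightarrow> real \<Rightarrow> complex). finite J \<Longrightarrow> (\<And>j. j \<in> J \<Longrightarrow> e j \<in> L2) \<Longrightarrow>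
     (\<And>i j. i \<in> J \<Longrightarrow> j \<in> J \<Longrightarrow> l2_inner (e i) (e j) = (if i = j then 1 else 0)) \<Longrightarrow>
     cmod (\<Sum>j\<in>J. l2_inner (G (e j)) (e j)) \<le> C"
proof
  have G: "bounded_op G" and summable: "summable (\<lambda>k. singular_value G (Suc k))"
    using assms by (auto simp: nuclear_def)
  fix J and e :: "'j \<Rightarrow> real \<Rightarrow> complex"
  assume J: "finite J" and e: "\<And>j. j \<in> J \<Longrightarrow> e j \<in> L2"
    and e_on: "\<And>i j. i \<in> J \<Longrightarrow> j \<in> J \<Longrightarrow> l2_inner (e i) (e j) = (if i = j then 1 else 0)"
  define N where "N = card J"
  \<comment> \<open>The infimum may not be attained; the errors \<open>(1/2) ^ k\<close> are
    summable.\<close>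
  have "\<exists>T. bounded_op T \<and> rank_less T (Suc k) \<and>
      op_norm (\<lambda>u t. G u t - T u t) < singular_value G (Suc k) + (1/2) ^ k" for k
    using singular_value_approx[OF G, of "(1/2) ^ k" k] by (metis zero_less_divide_1_iff zero_less_numeral zero_less_power)
  then obtain T where T: "\<And>k. bounded_op (T k)" and rank: "\<And>k. rank_less (T k) (Suc k)"
    and T_approx: "\<And>k. op_norm (\<lambda>u t. G u t - T k u t) < singular_value G (Suc k) + (1/2) ^ k"
    by metis
  \<comment> \<open>Vectors of the span are handled through their coordinates; by
    \<open>inner_comb_comb\<close> passing to coordinates preserves inner products.\<close>
  define comb where "comb x = (\<lambda>t. \<Sum>j\<in>J. x j * e j t)" for x
  have comb_L2: "comb x \<in> L2" for x
    unfolding comb_def by (intro L2_sum L2_scale e)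
  have inner_comb: "l2_inner u (comb x) = (\<Sum>j\<in>J. cnj (x j) * l2_inner u (e j))" if "u \<in> L2" for u x
    unfolding comb_def using that e
    by (subst l2_inner_sum_right) (auto simp: l2_inner_scale_right intro!: L2_scale)
  have inner_comb_left: "l2_inner (comb x) u = (\<Sum>j\<in>J. x j * l2_inner (e j) u)" if "u \<in> L2" for u x
    unfolding comb_def using that e
    by (subst l2_inner_sum_left) (auto simp: l2_inner_scale_left intro!: L2_scale)
  have inner_comb_e: "l2_inner (e j) (comb x) = cnj (x j)" if "j \<in> J" for j x
  proof -
    have "l2_inner (e j) (comb x) = (\<Sum>i\<in>J. if j = i then cnj (x i) else 0)"
      using that by (subst inner_comb[OF e]) (auto simp: e_on intro!: sum.cong)
    then show ?thesis using that J by simp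
  qed
  have inner_comb_comb: "l2_inner (comb x) (comb y) = (\<Sum>j\<in>J. x j * cnj (y j))" for x y
    by (simp add: inner_comb_left comb_L2 inner_comb_e)
  \<comment> \<open>The vector chosen at stage \<open>m\<close> is to be annihilated by
    \<open>T (N - Suc m)\<close>. That costs at most \<open>N - Suc m\<close> equations, and
    orthogonality to the earlier vectors costs \<open>m\<close>: together at most
    \<open>N - 1\<close> in \<open>N\<close> unknowns. For \<open>m \<ge> N\<close> nothing is
    demanded, so that the choice runs over all naturals.\<close>
  define good where "good y m r \<longleftrightarrow> (m < N \<longrightarrow> l2_inner (comb r) (comb r) = 1 \<and>
      (\<forall>i<m. l2_inner (comb r) (comb (y i)) = 0) \<and> ae_eq (T (N - Suc m) (comb r)) (\<lambda>t. 0))"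
    for y :: "nat \<Rightarrow> 'j \<Rightarrow> complex" and m r
  have good_ex: "\<exists>r. good y m r" for y m
  proof (cases "m < N")
    case True
    define S where "S = T (N - Suc m)"
    have S: "bounded_op S" unfolding S_def by (rule T)
    obtain B where B: "finite B" "card B < Suc (N - Suc m)"
      and span: "\<And>u. u \<in> L2 \<Longrightarrow> \<exists>c. ae_eq (S u) (\<lambda>t. \<Sum>b\<in>B. c b * b t)"
      using rank[of "N - Suc m"] unfolding rank_less_def S_def by blast
    obtain c where c: "\<And>j. j \<in> J \<Longrightarrow> ae_eq (S (e j)) (\<lambda>t. \<Sum>b\<in>B. c j b * b t)"
      using span[OF e] by metis
    \<comment> \<open>\<open>Inl\<close> indexes the orthogonality equations, \<open>Inr\<close> the
      coefficients of the image under \<open>S\<close> along \<open>B\<close>.\<close>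
    define I where "I = Inl ` {..<m} \<union> Inr ` B"
    define a where "a i j = (case i of Inl l \<Rightarrow> cnj (y l j) | Inr b \<Rightarrow> c j b)" for i j
    have "card I \<le> m + card B"
      unfolding I_def by (intro order_trans[OF card_Un_le] add_mono order_trans[OF card_image_le] B) auto
    then have "card I < card J" using B True by (simp add: N_def)
    moreover have "finite I" using B by (simp add: I_def)
    ultimately obtain x where x: "\<exists>j\<in>J. x j \<noteq> 0" "\<forall>i\<in>I. (\<Sum>j\<in>J. a i j * x j) = 0"
      using underdetermined_system J by blast
    define s where "s = (\<Sum>j\<in>J. (cmod (x j))\<^sup>2)"
    have "s \<noteq> 0" using x(1) J by (auto simp: s_def sum_nonneg_eq_0_iff)
    then have "s > 0" using sum_nonneg[of J "\<lambda>j. (cmod (x j))\<^sup>2"] by (simp add: s_def)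
    have s_inner: "l2_inner (comb x) (comb x) = of_real s"
      by (simp add: inner_comb_comb s_def complex_norm_square del: of_real_power)
    define q where "q = 1 / sqrt s"
    have "q * q * s = 1" using \<open>s > 0\<close> by (simp add: q_def)
    define r where "r = (\<lambda>j. of_real q * x j)"
    have comb_r: "comb r = (\<lambda>t. of_real q * comb x t)"
      by (simp add: comb_def r_def sum_distrib_left mult.assoc)
    have "l2_inner (comb r) (comb r) = 1"
    proof -
      have "l2_inner (comb r) (comb r) = of_real (q * q * s)"
        by (simp add: comb_r l2_inner_scale_left l2_inner_scale_right s_inner)
      then show ?thesis by (simp only: \<open>q * q * s = 1\<close> of_real_1)
    qed
    moreover have "l2_inner (comb r) (comb (y i)) = 0" if "i < m" for i
    proof -
      have "(\<Sum>j\<in>J. a (Inl i) j * x j) = 0" using x(2) that by (auto simp: I_def)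
      then have "l2_inner (comb x) (comb (y i)) = 0"
        by (simp add: inner_comb_comb a_def mult.commute)
      then show ?thesis unfolding comb_r by (simp add: l2_inner_scale_left)
    qed
    moreover have "ae_eq (S (comb r)) (\<lambda>t. 0)"
    proof -
      have "ae_eq (S (comb r)) (\<lambda>t. \<Sum>j\<in>J. r j * S (e j) t)"
        unfolding comb_def by (rule bounded_op_sum[OF S e J])
      also have "ae_eq \<dots> (\<lambda>t. \<Sum>j\<in>J. r j * (\<Sum>b\<in>B. c j b * b t))"
        by (intro ae_eq_sum ae_eq_scale c)
      also have "\<dots> = (\<lambda>t. 0)"
      proof
        fix t
        have "(\<Sum>j\<in>J. r j * (\<Sum>b\<in>B. c j b * b t)) = (\<Sum>j\<in>J. \<Sum>b\<in>B. of_real q * (a (Inr b) j * x j) * b t)"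
          by (simp add: sum_distrib_left r_def a_def algebra_simps)
        also have "\<dots> = (\<Sum>b\<in>B. of_real q * (\<Sum>j\<in>J. a (Inr b) j * x j) * b t)"
          by (subst sum.swap) (simp add: sum_distrib_left sum_distrib_right)
        also have "\<dots> = 0" using x(2) by (intro sum.neutral) (auto simp: I_def)
        finally show "(\<Sum>j\<in>J. r j * (\<Sum>b\<in>B. c j b * b t)) = 0" .
      qed
      finally show ?thesis .
    qed
    ultimately show ?thesis unfolding good_def S_def by blast
  qed (simp add: good_def)
  have "\<exists>y. \<forall>m. good y m (y m)"
  proof (rule dependent_wellorder_choice)
    fix r and f g :: "nat \<Rightarrow> 'j \<Rightarrow> complex" and m :: nat
    assume "\<And>i. i < m \<Longrightarrow> f i = g i"
    then show "good f m r = good g m r" by (simp add: good_def)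
  qed (rule good_ex)
  then obtain y where y: "\<And>m. good y m (y m)" by blast
  define f where "f m = comb (y m)" for m
  have f_L2: "f m \<in> L2" for m unfolding f_def by (rule comb_L2)
  have f_self: "l2_inner (f m) (f m) = 1" and f_perp: "\<And>i. i < m \<Longrightarrow> l2_inner (f m) (f i) = 0"
    and f_ker: "ae_eq (T (N - Suc m) (f m)) (\<lambda>t. 0)" if "m < N" for m
    using y[of m] that by (auto simp: good_def f_def)
  have f_norm: "l2norm (f m) = 1" if "m < N" for m
  proof -
    have "(l2norm (f m))\<^sup>2 = 1" using f_self[OF that] unfolding l2_inner_self by (metis of_real_1 of_real_eq_iff)
    then show ?thesis using l2norm_nonneg[of "f m"] by (simp add: power2_eq_1_iff)
  qed
  have "l2_inner (f i) (f j) = 0" if "i < N" "j < N" "i \<noteq> j" for i j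
    using that f_perp[of i j] f_perp[of j i] l2_inner_cnj[of "f i" "f j"] by (cases i j rule: linorder_cases) auto
  then have ortho: "ortho f N" unfolding ortho_def by (simp add: f_L2 f_norm)
  have norm_e: "l2norm (e j) = 1" if "j \<in> J" for j
  proof -
    have "(l2norm (e j))\<^sup>2 = 1" using e_on[OF that that] unfolding l2_inner_self by (simp flip: of_real_power)
    then show ?thesis using l2norm_nonneg[of "e j"] by (simp add: power2_eq_1_iff)
  qed
  let ?r = "\<lambda>j. l2norm (\<lambda>t. e j t - ortho_proj f N (e j) t)"
  \<comment> \<open>Counting squared norms shows that the \<open>f m\<close> span the same space:
    the squares of the coefficients already add up to \<open>N\<close>, because every
    \<open>f m\<close> is a unit vector, so no residual is left for any \<open>e j\<close>.\<close>
  have "real N = (\<Sum>j\<in>J. (l2norm (e j))\<^sup>2)" by (simp add: norm_e N_def)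
  also have "\<dots> = (\<Sum>j\<in>J. (?r j)\<^sup>2 + (\<Sum>m<N. (cmod (y m j))\<^sup>2))"
    by (intro sum.cong refl) (subst ortho_proj_pythagoras[OF ortho e], auto simp: f_def inner_comb_e)
  also have "\<dots> = (\<Sum>j\<in>J. (?r j)\<^sup>2) + (\<Sum>m<N. \<Sum>j\<in>J. (cmod (y m j))\<^sup>2)"
    unfolding sum.distrib by (subst (2) sum.swap) simp
  also have "(\<Sum>m<N. \<Sum>j\<in>J. (cmod (y m j))\<^sup>2) = (\<Sum>m<N. 1)"
  proof (intro sum.cong refl)
    fix m assume "m \<in> {..<N}"
    then have "complex_of_real (\<Sum>j\<in>J. (cmod (y m j))\<^sup>2) = 1"
      using f_self[of m] by (simp add: f_def inner_comb_comb complex_norm_square del: of_real_power)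
    then show "(\<Sum>j\<in>J. (cmod (y m j))\<^sup>2) = 1" by (metis of_real_1 of_real_eq_iff)
  qed
  finally have "(\<Sum>j\<in>J. (?r j)\<^sup>2) = 0" by simp
  then have "?r j = 0" if "j \<in> J" for j
    using that J by (simp add: sum_nonneg_eq_0_iff)
  then have e_proj: "ae_eq (e j) (ortho_proj f N (e j))" if "j \<in> J" for j
    using that by (simp add: ae_eq_iff_l2norm_diff e ortho_proj_L2[OF ortho])
  have Ge: "l2_inner (G (e j)) (e j) = (\<Sum>m<N. cnj (y m j) * l2_inner (G (f m)) (e j))" if j: "j \<in> J" for j
  proof -
    have "ae_eq (G (e j)) (G (ortho_proj f N (e j)))"
      by (rule bounded_op_ae[OF G e[OF j] ortho_proj_L2[OF ortho] e_proj[OF j]])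
    also have "ae_eq \<dots> (\<lambda>t. \<Sum>m<N. l2_inner (e j) (f m) * G (f m) t)"
      unfolding ortho_proj_def by (rule bounded_op_sum[OF G]) (auto intro: f_L2)
    finally have "l2_inner (G (e j)) (e j) = l2_inner (\<lambda>t. \<Sum>m<N. l2_inner (e j) (f m) * G (f m) t) (e j)"
      by (rule l2_inner_ae_cong_left[rotated 3]) (auto intro!: L2_sum L2_scale bounded_op_L2[OF G] f_L2 e j)
    also have "\<dots> = (\<Sum>m<N. l2_inner (e j) (f m) * l2_inner (G (f m)) (e j))"
      by (subst l2_inner_sum_left) (auto simp: l2_inner_scale_left intro!: L2_scale bounded_op_L2[OF G] f_L2 e j)
    finally show ?thesis by (simp add: f_def inner_comb_e[OF j])
  qed
  \<comment> \<open>Basis invariance of the trace: summing over \<open>j\<close> first reassembles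
    \<open>f m\<close> in the second argument.\<close>
  have "(\<Sum>j\<in>J. l2_inner (G (e j)) (e j)) = (\<Sum>m<N. \<Sum>j\<in>J. cnj (y m j) * l2_inner (G (f m)) (e j))"
    by (subst sum.swap) (simp add: Ge)
  also have "\<dots> = (\<Sum>m<N. l2_inner (G (f m)) (f m))"
    by (simp add: f_def inner_comb bounded_op_L2[OF G comb_L2])
  also have "cmod \<dots> \<le> (\<Sum>m<N. cmod (l2_inner (G (f m)) (f m)))"
    by (rule norm_sum)
  also have "\<dots> \<le> (\<Sum>m<N. singular_value G (Suc (N - Suc m)) + (1/2) ^ (N - Suc m))"
  proof (rule sum_mono)
    fix m assume "m \<in> {..<N}"
    then have m: "m < N" by simp
    let ?T = "T (N - Suc m)"
    let ?D = "\<lambda>u t. G u t - ?T u t"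
    have D: "bounded_op ?D" by (intro bounded_op_diff G T)
    have "l2_inner (?D (f m)) (f m) = l2_inner (G (f m)) (f m) - l2_inner (?T (f m)) (f m)"
      by (intro l2_inner_diff_left bounded_op_L2[OF G] bounded_op_L2[OF T] f_L2)
    also have "l2_inner (?T (f m)) (f m) = l2_inner (\<lambda>t. 0) (f m)"
      by (intro l2_inner_ae_cong_left bounded_op_L2[OF T] f_L2 L2_zero f_ker m)
    finally have "cmod (l2_inner (G (f m)) (f m)) = cmod (l2_inner (?D (f m)) (f m))"
      by (simp add: l2_inner_zero_left)
    also have "\<dots> \<le> l2norm (?D (f m)) * l2norm (f m)"
      by (intro l2_Cauchy_Schwarz bounded_op_L2[OF D] f_L2)
    also have "\<dots> \<le> op_norm ?D"
      using op_norm_upper[OF D f_L2, of m] f_norm[OF m] by simp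
    also note T_approx[of "N - Suc m"]
    finally show "cmod (l2_inner (G (f m)) (f m)) \<le> singular_value G (Suc (N - Suc m)) + (1/2) ^ (N - Suc m)"
      by simp
  qed
  also have "\<dots> = (\<Sum>k<N. singular_value G (Suc k) + (1/2) ^ k)"
    by (rule sum.nat_diff_reindex)
  also have "\<dots> \<le> (\<Sum>k. singular_value G (Suc k) + (1/2) ^ k)"
    using summable singular_value_nonneg[OF G] by (intro sum_le_suminf summable_add summable_geometric) auto
  finally show "cmod (\<Sum>j\<in>J. l2_inner (G (e j)) (e j)) \<le> (\<Sum>k. singular_value G (Suc k) + (1/2) ^ k)" .
qed

section \<open>Sufficiency\<close>

locale laplace_hankel =
  fixes M :: "complex measure" and \<theta> :: "complex \<Rightarrow> complex"
    and h :: "real \<Rightarrow> complex" and w :: "real \<Rightarrow> real"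
  assumes mu: "sigma_finite_complex_measure M \<theta>"
    and exp_int: "\<And>t. t > 0 \<Longrightarrow> (\<integral>\<^sup>+p. ennreal (cmod (exp (of_real t * p))) \<partial>M) < \<infinity>"
    and h: "\<And>t. t > 0 \<Longrightarrow> h t = cm_integral M \<theta> (\<lambda>p. exp (of_real t * p))"
    and w_meas: "w \<in> borel_measurable (lebesgue_on {0<..})"
    and w_pos: "\<And>t. t > 0 \<Longrightarrow> w t > 0"
    and psi_L2: "\<And>p. p \<in> left_half_plane \<Longrightarrow> psi w p \<in> L2"
begin

sublocale pair_sigma_finite halfline M
  using mu sigma_finite_halfline by (simp add: sigma_finite_complex_measure_def pair_sigma_finite_def)

section \<open>Measurability, the kernel as a superposition, and the transform
  \<open>a\<^sub>u\<close>\<close>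

lemma space_M: "space M = left_half_plane"
proof -
  have "sets M = sets (restrict_space borel left_half_plane)"
    using mu by (simp add: sigma_finite_complex_measure_def)
  from sets_eq_imp_space_eq[OF this] show ?thesis by (simp add: space_restrict_space)
qed

lemma ident_measurable_M [measurable]: "(\<lambda>p. p) \<in> borel_measurable M"
proof -
  have "(\<lambda>p. p) \<in> borel_measurable (restrict_space borel left_half_plane)"
    by (intro measurable_restrict_space1) simp
  moreover have "sets M = sets (restrict_space borel left_half_plane)"
    using mu by (simp add: sigma_finite_complex_measure_def)
  note measurable_cong_sets[OF this refl, of "borel :: complex measure"]
  ultimately show ?thesis by (simp only:)
qed

lemma ident_measurable_halfline [measurable]: "(\<lambda>t. t) \<in> borel_measurable halfline"
  by (intro measurable_restrict_space1 measurable_completion) simp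

lemma theta_measurable [measurable]: "\<theta> \<in> borel_measurable M"
  and theta_norm: "p \<in> left_half_plane \<Longrightarrow> cmod (\<theta> p) = 1"
  using mu by (auto simp: sigma_finite_complex_measure_def)

declare w_meas [measurable]

lemma psi_measurable_pair [measurable]:
  "(\<lambda>(t, p). psi w p t) \<in> borel_measurable (halfline \<Otimes>\<^sub>M M)"
  unfolding psi_def by measurable

lemma psi_measurable_pair' [measurable]:
  "(\<lambda>(p, t). psi w p t) \<in> borel_measurable (M \<Otimes>\<^sub>M halfline)"
  unfolding psi_def by measurable

lemma psi_measurable_M [measurable]: "(\<lambda>p. psi w p t) \<in> borel_measurable M"
  unfolding psi_def by measurable

lemma psi_measurable_halfline [measurable]: "psi w p \<in> borel_measurable halfline"
  unfolding psi_def by measurable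

text \<open>Squaring the modulus doubles the exponent, so the integrability hypothesis is used at
  \<open>2 * t\<close>.\<close>

lemma psi_sq_integrable:
  assumes "t > 0" shows "integrable M (\<lambda>p. (cmod (psi w p t))\<^sup>2)"
proof -
  have "integrable M (\<lambda>p. cmod (exp (of_real (2 * t) * p)))"
    using exp_int[of "2 * t"] assms by (intro integrableI_bounded) (auto)
  moreover have "(cmod (psi w p t))\<^sup>2 = (w t)\<^sup>2 * cmod (exp (of_real (2 * t) * p))" for p
  proof -
    have "(exp (t * Re p))\<^sup>2 = exp (2 * t * Re p)"
      by (simp add: power2_eq_square flip: exp_add)
    then show ?thesis
      by (simp add: psi_def norm_mult power_mult_distrib mult.commute)
  qed
  ultimately show ?thesis by simp
qed

text \<open>The exponential of \<open>(t + \<tau>) p\<close> factors, so the Hankel kernel is a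
  superposition of the rank-one kernels
  \<open>\<psi>\<^sub>p(t) \<psi>\<^sub>p(\<tau>)\<close>.\<close>

lemma hankel_integrand_eq:
  assumes "t > 0" "\<tau> > 0"
  shows "hankel_integrand h w u t \<tau> = (\<integral>p. \<theta> p * psi w p t * (psi w p \<tau> * u \<tau>) \<partial>M)"
proof -
  have eq: "\<theta> p * psi w p t * (psi w p \<tau> * u \<tau>)
      = of_real (w t) * (exp (of_real (t + \<tau>) * p) * \<theta> p) * of_real (w \<tau>) * u \<tau>" for p
  proof -
    have "exp (of_real (t + \<tau>) * p) = exp (p * of_real t) * exp (p * of_real \<tau>)"
      by (simp add: algebra_simps flip: exp_add)
    then show ?thesis by (simp add: psi_def mult_ac)
  qed
  show ?thesis
    unfolding eq using assms by (simp add: hankel_integrand_def h cm_integral_def del: of_real_add)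
qed

text \<open>This is \<open>a\<^sub>u(p)\<close>; the pairing is bilinear, without
  conjugation.\<close>

definition psi_transform :: "(real \<Rightarrow> complex) \<Rightarrow> complex \<Rightarrow> complex" where
  "psi_transform u p = (\<integral>t. psi w p t * u t \<partial>halfline)"

lemma psi_transform_measurable [measurable]:
  assumes "u \<in> L2" shows "psi_transform u \<in> borel_measurable M"
proof -
  note L2_measurable[OF assms, measurable]
  show ?thesis unfolding psi_transform_def[abs_def] by measurable
qed

lemma integral_psi_mult_le:
  assumes "u \<in> L2" "p \<in> left_half_plane"
  shows "(\<integral>t. cmod (psi w p t * u t) \<partial>halfline) \<le> l2norm (psi w p) * l2norm u"
  using integral_cmod_mult_le[OF psi_L2 assms(1), OF assms(2)] by (simp add: norm_mult)

lemma nn_integral_psi_mult_le: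
  assumes "u \<in> L2" "p \<in> left_half_plane"
  shows "(\<integral>\<^sup>+t. ennreal (cmod (psi w p t * u t)) \<partial>halfline) \<le> ennreal (l2norm (psi w p) * l2norm u)"
  using integral_psi_mult_le[OF assms] L2_mult_integrable[OF psi_L2 assms(1), OF assms(2)]
  by (simp add: nn_integral_eq_integral ennreal_leI del: norm_mult)

lemma psi_transform_le:
  assumes "u \<in> L2" "p \<in> left_half_plane"
  shows "cmod (psi_transform u p) \<le> l2norm (psi w p) * l2norm u"
  unfolding psi_transform_def
  by (rule order_trans[OF integral_norm_bound integral_psi_mult_le[OF assms]])

lemma psi_transform_scale: "psi_transform (\<lambda>t. a * u t) p = a * psi_transform u p"
  by (simp add: psi_transform_def mult.left_commute[of _ a])

lemma l2norm_psi_measurable [measurable]: "(\<lambda>p. l2norm (psi w p)) \<in> borel_measurable M"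
  unfolding l2norm_def by measurable

end

locale laplace_hankel_HS = laplace_hankel +
  assumes HS: "(\<integral>\<^sup>+p. ennreal ((l2norm (psi w p))\<^sup>2) \<partial>M) < \<infinity>"
begin

lemma HS_integrable: "integrable M (\<lambda>p. (l2norm (psi w p))\<^sup>2)"
  using HS by (intro integrableI_bounded) auto

text \<open>The squared Hilbert-Schmidt norm of \<open>psi_transform\<close> as an operator from the
  half-line into the square-integrable functions over \<open>M\<close>.\<close>

definition "HSnorm2 = (\<integral>p. (l2norm (psi w p))\<^sup>2 \<partial>M)"

lemma HSnorm2_nonneg: "0 \<le> HSnorm2"
  unfolding HSnorm2_def by (intro integral_nonneg_AE) simp

text \<open>The squared norm of \<open>a\<^sub>u\<close> over \<open>M\<close>; it serves as
  \<open>Q\<close> in the nuclearity criterion.\<close>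

definition "energy u = (\<integral>p. (cmod (psi_transform u p))\<^sup>2 \<partial>M)"

lemma energy_integrable:
  assumes "u \<in> L2" shows "integrable M (\<lambda>p. (cmod (psi_transform u p))\<^sup>2)"
proof (rule Bochner_Integration.integrable_bound)
  show "integrable M (\<lambda>p. (l2norm u)\<^sup>2 * (l2norm (psi w p))\<^sup>2)"
    using HS_integrable by simp
  show "AE p in M. norm ((cmod (psi_transform u p))\<^sup>2) \<le> norm ((l2norm u)\<^sup>2 * (l2norm (psi w p))\<^sup>2)"
    using psi_transform_le[OF assms]
    by (intro AE_I2) (auto simp: space_M power_mult_distrib[symmetric] mult.commute intro!: power_mono)
qed (use assms in measurable)

lemma energy_le:
  assumes "u \<in> L2" shows "energy u \<le> HSnorm2 * (l2norm u)\<^sup>2"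
proof -
  have "(cmod (psi_transform u p))\<^sup>2 \<le> (l2norm (psi w p))\<^sup>2 * (l2norm u)\<^sup>2" if "p \<in> space M" for p
    using power_mono[OF psi_transform_le[OF assms, of p], of 2] that by (simp add: space_M power_mult_distrib)
  then have "energy u \<le> (\<integral>p. (l2norm (psi w p))\<^sup>2 * (l2norm u)\<^sup>2 \<partial>M)"
    unfolding energy_def using HS_integrable by (intro integral_mono energy_integrable assms) auto
  then show ?thesis by (simp add: HSnorm2_def)
qed

text \<open>For each \<open>p\<close>, \<open>a\<^sub>e(p)\<close> is the inner product of
  \<open>\<psi>\<^sub>p\<close> with the conjugate of \<open>e\<close>. Bessel's inequality for the
  conjugate family is then integrated over \<open>p\<close>.\<close>

lemma energy_ortho_sum:
  assumes "ortho e n" shows "(\<Sum>i<n. energy (e i)) \<le> HSnorm2"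
proof -
  have "(\<Sum>i<n. energy (e i)) = (\<integral>p. (\<Sum>i<n. (cmod (psi_transform (e i) p))\<^sup>2) \<partial>M)"
    unfolding energy_def using assms
    by (intro Bochner_Integration.integral_sum[symmetric] energy_integrable) (auto dest: orthoD)
  also have "\<dots> \<le> HSnorm2"
    unfolding HSnorm2_def
  proof (rule integral_mono)
    show "integrable M (\<lambda>p. \<Sum>i<n. (cmod (psi_transform (e i) p))\<^sup>2)"
      using assms by (intro Bochner_Integration.integrable_sum energy_integrable) (auto dest: orthoD)
    fix p assume "p \<in> space M"
    then have "psi w p \<in> L2" by (simp add: space_M psi_L2)
    from Bessel_inequality[OF ortho_cnj[OF assms] this]
    show "(\<Sum>i<n. (cmod (psi_transform (e i) p))\<^sup>2) \<le> (l2norm (psi w p))\<^sup>2"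
      by (simp add: l2_inner_def psi_transform_def)
  qed (rule HS_integrable)
  finally show ?thesis .
qed

section \<open>Convergence of the defining integral and the representation of
  \<open>\<Gamma> u\<close>\<close>

lemma integrable_psi_psi:
  assumes "t > 0" shows "integrable M (\<lambda>p. cmod (psi w p t) * l2norm (psi w p))"
proof (rule Bochner_Integration.integrable_bound)
  show "integrable M (\<lambda>p. (cmod (psi w p t))\<^sup>2 + (l2norm (psi w p))\<^sup>2)"
    using psi_sq_integrable[OF assms] HS_integrable by simp
  have "x * y \<le> x\<^sup>2 + y\<^sup>2" if "0 \<le> x" "0 \<le> y" for x y :: real
    using sum_squares_bound[of x y] that mult_nonneg_nonneg[of x y] by linarith
  then show "AE p in M. norm (cmod (psi w p t) * l2norm (psi w p))
      \<le> norm ((cmod (psi w p t))\<^sup>2 + (l2norm (psi w p))\<^sup>2)"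
    by (simp add: abs_mult)
qed measurable

text \<open>Justifies Fubini at fixed \<open>t\<close>: Cauchy-Schwarz in \<open>\<tau>\<close>
  leaves a multiple of \<open>\<bar>\<psi>\<^sub>p(t)\<bar>
  \<parallel>\<psi>\<^sub>p\<parallel>\<close>, a product of two functions of \<open>p\<close> that
  are square integrable over \<open>M\<close>.\<close>

lemma integrable_kernel:
  assumes u: "u \<in> L2" and t: "t > 0"
  shows "integrable (halfline \<Otimes>\<^sub>M M) (\<lambda>(\<tau>, p). \<theta> p * psi w p t * (psi w p \<tau> * u \<tau>))"
proof (rule integrableI_bounded)
  note L2_measurable[OF u, measurable]
  show meas: "(\<lambda>(\<tau>, p). \<theta> p * psi w p t * (psi w p \<tau> * u \<tau>)) \<in> borel_measurable (halfline \<Otimes>\<^sub>M M)"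
    by measurable
  have "(\<integral>\<^sup>+z. ennreal (norm (case z of (\<tau>, p) \<Rightarrow> \<theta> p * psi w p t * (psi w p \<tau> * u \<tau>))) \<partial>(halfline \<Otimes>\<^sub>M M))
      = (\<integral>\<^sup>+p. (\<integral>\<^sup>+\<tau>. ennreal (norm (\<theta> p * psi w p t * (psi w p \<tau> * u \<tau>))) \<partial>halfline) \<partial>M)"
    using meas by (subst nn_integral_snd[symmetric]) (auto simp: split_beta')
  also have "\<dots> \<le> (\<integral>\<^sup>+p. ennreal (l2norm u * (cmod (psi w p t) * l2norm (psi w p))) \<partial>M)"
  proof (rule nn_integral_mono)
    fix p assume "p \<in> space M"
    then have p: "p \<in> left_half_plane" by (simp add: space_M)
    have "(\<integral>\<^sup>+\<tau>. ennreal (norm (\<theta> p * psi w p t * (psi w p \<tau> * u \<tau>))) \<partial>halfline)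
        = ennreal (cmod (psi w p t)) * (\<integral>\<^sup>+\<tau>. ennreal (cmod (psi w p \<tau> * u \<tau>)) \<partial>halfline)"
      by (subst nn_integral_cmult[symmetric]) (auto simp: norm_mult theta_norm[OF p] ennreal_mult'[symmetric])
    also have "\<dots> \<le> ennreal (cmod (psi w p t)) * ennreal (l2norm (psi w p) * l2norm u)"
      by (intro mult_left_mono nn_integral_psi_mult_le u p) simp
    finally show "(\<integral>\<^sup>+\<tau>. ennreal (norm (\<theta> p * psi w p t * (psi w p \<tau> * u \<tau>))) \<partial>halfline)
        \<le> ennreal (l2norm u * (cmod (psi w p t) * l2norm (psi w p)))"
      by (simp add: ennreal_mult'[symmetric] mult_ac)
  qed
  also have "\<dots> < \<infinity>"
    using integrable_psi_psi[OF t] by (subst nn_integral_eq_integral) auto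
  finally show "(\<integral>\<^sup>+z. ennreal (norm (case z of (\<tau>, p) \<Rightarrow> \<theta> p * psi w p t * (psi w p \<tau> * u \<tau>)))
      \<partial>(halfline \<Otimes>\<^sub>M M)) < \<infinity>" .
qed

lemma hankel_integrand_integrable:
  assumes u: "u \<in> L2" and t: "t > 0"
  shows "integrable halfline (hankel_integrand h w u t)"
proof -
  have "integrable halfline (\<lambda>\<tau>. \<integral>p. \<theta> p * psi w p t * (psi w p \<tau> * u \<tau>) \<partial>M)"
    using integrable_fst[OF integrable_kernel[OF assms]] by simp
  moreover have "integrable halfline (hankel_integrand h w u t)
      = integrable halfline (\<lambda>\<tau>. \<integral>p. \<theta> p * psi w p t * (psi w p \<tau> * u \<tau>) \<partial>M)"
    using t by (intro Bochner_Integration.integrable_cong refl hankel_integrand_eq) auto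
  ultimately show ?thesis by simp
qed

lemma weighted_hankel_eq:
  assumes u: "u \<in> L2" and t: "t > 0"
  shows "weighted_hankel h w u t = (\<integral>p. \<theta> p * psi w p t * psi_transform u p \<partial>M)"
proof -
  have "weighted_hankel h w u t = (\<integral>\<tau>. (\<integral>p. \<theta> p * psi w p t * (psi w p \<tau> * u \<tau>) \<partial>M) \<partial>halfline)"
    unfolding weighted_hankel_def using t
    by (intro Bochner_Integration.integral_cong refl hankel_integrand_eq) auto
  also have "\<dots> = (\<integral>p. (\<integral>\<tau>. \<theta> p * psi w p t * (psi w p \<tau> * u \<tau>) \<partial>halfline) \<partial>M)"
    by (rule Fubini_integral[symmetric, OF integrable_kernel[OF assms]])
  finally show ?thesis by (simp add: psi_transform_def)
qed

lemma weighted_hankel_measurable: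
  assumes u: "u \<in> L2" shows "weighted_hankel h w u \<in> borel_measurable halfline"
proof -
  note psi_transform_measurable[OF u, measurable]
  have "(\<lambda>t. \<integral>p. \<theta> p * psi w p t * psi_transform u p \<partial>M) \<in> borel_measurable halfline"
    by measurable
  then show ?thesis
    by (subst measurable_cong[OF weighted_hankel_eq[OF u]]) auto
qed

text \<open>If \<open>\<mu> \<ge> 0\<close> is supported on the negative reals, this is the diagonal
  \<open>w(t)\<^sup>2 h(2t)\<close> of the kernel. Its integral over the half-line is
  \<open>HSnorm2\<close> by Fubini.\<close>

definition "trace_density t = (\<integral>p. (cmod (psi w p t))\<^sup>2 \<partial>M)"

lemma integrable_psi_sq_pair: "integrable (halfline \<Otimes>\<^sub>M M) (\<lambda>(t, p). (cmod (psi w p t))\<^sup>2)"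
proof (rule integrableI_bounded)
  have "(\<integral>\<^sup>+z. ennreal (norm (case z of (t, p) \<Rightarrow> (cmod (psi w p t))\<^sup>2)) \<partial>(halfline \<Otimes>\<^sub>M M))
      = (\<integral>\<^sup>+p. (\<integral>\<^sup>+t. ennreal ((cmod (psi w p t))\<^sup>2) \<partial>halfline) \<partial>M)"
    by (subst nn_integral_snd[symmetric]) (auto simp: split_beta')
  also have "\<dots> = (\<integral>\<^sup>+p. ennreal ((l2norm (psi w p))\<^sup>2) \<partial>M)"
    by (intro nn_integral_cong nn_integral_L2 psi_L2) (simp add: space_M)
  also note HS
  finally show "(\<integral>\<^sup>+z. ennreal (norm (case z of (t, p) \<Rightarrow> (cmod (psi w p t))\<^sup>2)) \<partial>(halfline \<Otimes>\<^sub>M M)) < \<infinity>" .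
qed measurable

lemma trace_density_integrable: "integrable halfline trace_density"
  using integrable_fst[OF integrable_psi_sq_pair] by (simp add: trace_density_def[abs_def])

lemma integral_trace_density: "(\<integral>t. trace_density t \<partial>halfline) = HSnorm2"
  using Fubini_integral[OF integrable_psi_sq_pair]
  by (simp add: trace_density_def HSnorm2_def l2norm_power2)

text \<open>Cauchy-Schwarz in \<open>p\<close> separates \<open>t\<close> from \<open>u\<close>;
  integrating over \<open>t\<close> then yields both membership in \<open>L2\<close> and the
  operator bound \<open>HSnorm2\<close>.\<close>

lemma weighted_hankel_pointwise_le:
  assumes u: "u \<in> L2" and t: "t > 0"
  shows "(cmod (weighted_hankel h w u t))\<^sup>2 \<le> HSnorm2 * (l2norm u)\<^sup>2 * trace_density t"
proof -
  note psi_transform_measurable[OF u, measurable]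
  have "cmod (weighted_hankel h w u t) \<le> (\<integral>p. cmod (\<theta> p * psi w p t * psi_transform u p) \<partial>M)"
    unfolding weighted_hankel_eq[OF assms] by (rule integral_norm_bound)
  also have "\<dots> = (\<integral>p. cmod (psi w p t) * cmod (psi_transform u p) \<partial>M)"
    by (intro Bochner_Integration.integral_cong refl) (simp add: space_M norm_mult theta_norm)
  also have "\<dots> \<le> sqrt (trace_density t) * sqrt (energy u)"
    unfolding trace_density_def energy_def
    by (intro integral_Cauchy_Schwarz psi_sq_integrable t energy_integrable u) measurable
  finally have "(cmod (weighted_hankel h w u t))\<^sup>2 \<le> (sqrt (trace_density t) * sqrt (energy u))\<^sup>2"
    by (intro power_mono) auto
  also have "\<dots> = trace_density t * energy u"
  proof -
    have "0 \<le> trace_density t" "0 \<le> energy u"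
      unfolding trace_density_def energy_def by (auto intro: integral_nonneg_AE)
    then show ?thesis by (simp add: power_mult_distrib)
  qed
  also have "\<dots> \<le> trace_density t * (HSnorm2 * (l2norm u)\<^sup>2)"
    by (intro mult_left_mono energy_le u) (auto simp: trace_density_def intro: integral_nonneg_AE)
  finally show ?thesis by (simp add: mult_ac)
qed

lemma weighted_hankel_L2:
  assumes u: "u \<in> L2" shows "weighted_hankel h w u \<in> L2"
proof -
  note weighted_hankel_measurable[OF u, measurable]
  have "integrable halfline (\<lambda>t. (cmod (weighted_hankel h w u t))\<^sup>2)"
  proof (rule Bochner_Integration.integrable_bound)
    show "integrable halfline (\<lambda>t. HSnorm2 * (l2norm u)\<^sup>2 * trace_density t)"
      using trace_density_integrable by simp
    show "AE t in halfline. norm ((cmod (weighted_hankel h w u t))\<^sup>2)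
        \<le> norm (HSnorm2 * (l2norm u)\<^sup>2 * trace_density t)"
      using weighted_hankel_pointwise_le[OF u] by (intro AE_I2) (auto intro: order_trans[OF _ abs_ge_self])
  qed measurable
  then show ?thesis by (simp add: L2_def weighted_hankel_measurable[OF u])
qed

lemma weighted_hankel_bounded_op: "bounded_op (weighted_hankel h w)"
  unfolding bounded_op_def
proof (intro conjI ballI allI impI)
  fix u v :: "real \<Rightarrow> complex" and a b :: complex assume u: "u \<in> L2" and v: "v \<in> L2"
  show "ae_eq (weighted_hankel h w u) (weighted_hankel h w v)" if "ae_eq u v"
  proof (rule ae_eq_pointwise)
    fix t :: real assume t: "t > 0"
    have "AE \<tau> in halfline. hankel_integrand h w u t \<tau> = hankel_integrand h w v t \<tau>"
      using that unfolding ae_eq_def by eventually_elim (simp add: hankel_integrand_def)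
    then show "weighted_hankel h w u t = weighted_hankel h w v t"
      unfolding weighted_hankel_def
      by (intro integral_cong_AE borel_measurable_integrable hankel_integrand_integrable u v t)
  qed
  show "ae_eq (weighted_hankel h w (\<lambda>t. a * u t + b * v t))
      (\<lambda>t. a * weighted_hankel h w u t + b * weighted_hankel h w v t)"
  proof (rule ae_eq_pointwise)
    fix t :: real assume t: "t > 0"
    have "weighted_hankel h w (\<lambda>t. a * u t + b * v t) t
        = (\<integral>\<tau>. a * hankel_integrand h w u t \<tau> + b * hankel_integrand h w v t \<tau> \<partial>halfline)"
      unfolding weighted_hankel_def
      by (intro Bochner_Integration.integral_cong refl) (simp add: hankel_integrand_def algebra_simps)
    also have "\<dots> = a * weighted_hankel h w u t + b * weighted_hankel h w v t"
      unfolding weighted_hankel_def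
      using hankel_integrand_integrable[OF u t] hankel_integrand_integrable[OF v t] by simp
    finally show "weighted_hankel h w (\<lambda>t. a * u t + b * v t) t
        = a * weighted_hankel h w u t + b * weighted_hankel h w v t" .
  qed
next
  have "l2norm (weighted_hankel h w u) \<le> HSnorm2 * l2norm u" if u: "u \<in> L2" for u
  proof (rule power2_le_imp_le)
    have "(l2norm (weighted_hankel h w u))\<^sup>2 \<le> (\<integral>t. HSnorm2 * (l2norm u)\<^sup>2 * trace_density t \<partial>halfline)"
      unfolding l2norm_power2[of "weighted_hankel h w u"]
      using weighted_hankel_pointwise_le[OF u] trace_density_integrable
      by (intro integral_mono L2_integrable weighted_hankel_L2[OF u]) auto
    also have "\<dots> = (HSnorm2 * l2norm u)\<^sup>2"
      by (simp add: integral_trace_density power2_eq_square)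
    finally show "(l2norm (weighted_hankel h w u))\<^sup>2 \<le> (HSnorm2 * l2norm u)\<^sup>2" .
  qed (simp add: HSnorm2_nonneg)
  then show "\<exists>C. \<forall>u\<in>L2. l2norm (weighted_hankel h w u) \<le> C * l2norm u" by blast
qed (rule weighted_hankel_L2)

text \<open>Fubini once more, now in \<open>t\<close> and \<open>p\<close>, with
  \<open>\<parallel>u\<parallel> \<parallel>v\<parallel>
  \<parallel>\<psi>\<^sub>p\<parallel>\<^sup>2\<close> as a bound for the inner integral.\<close>

lemma weighted_hankel_form:
  assumes u: "u \<in> L2" and v: "v \<in> L2"
  shows "l2_inner (weighted_hankel h w u) v
    = (\<integral>p. \<theta> p * psi_transform u p * psi_transform (\<lambda>t. cnj (v t)) p \<partial>M)"
proof -
  note psi_transform_measurable[OF u, measurable] L2_measurable[OF L2_cnj[OF v], measurable]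
    L2_measurable[OF v, measurable]
  let ?F = "\<lambda>t p. \<theta> p * psi_transform u p * (psi w p t * cnj (v t))"
  have int: "integrable (halfline \<Otimes>\<^sub>M M) (\<lambda>(t, p). ?F t p)"
  proof (rule integrableI_bounded)
    show meas: "(\<lambda>(t, p). ?F t p) \<in> borel_measurable (halfline \<Otimes>\<^sub>M M)" by measurable
    have "(\<integral>\<^sup>+z. ennreal (norm (case z of (t, p) \<Rightarrow> ?F t p)) \<partial>(halfline \<Otimes>\<^sub>M M))
        = (\<integral>\<^sup>+p. (\<integral>\<^sup>+t. ennreal (norm (?F t p)) \<partial>halfline) \<partial>M)"
      using meas by (subst nn_integral_snd[symmetric]) (auto simp: split_beta')
    also have "\<dots> \<le> (\<integral>\<^sup>+p. ennreal (l2norm u * l2norm v * (l2norm (psi w p))\<^sup>2) \<partial>M)"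
    proof (rule nn_integral_mono)
      fix p assume "p \<in> space M"
      then have p: "p \<in> left_half_plane" by (simp add: space_M)
      have "(\<integral>\<^sup>+t. ennreal (norm (?F t p)) \<partial>halfline)
          = ennreal (cmod (psi_transform u p)) * (\<integral>\<^sup>+t. ennreal (cmod (psi w p t * cnj (v t))) \<partial>halfline)"
        by (subst nn_integral_cmult[symmetric]) (auto simp: norm_mult theta_norm[OF p] ennreal_mult'[symmetric])
      also have "\<dots> \<le> ennreal (l2norm (psi w p) * l2norm u) * ennreal (l2norm (psi w p) * l2norm (\<lambda>t. cnj (v t)))"
        by (intro mult_mono nn_integral_psi_mult_le L2_cnj v p ennreal_leI psi_transform_le u) auto
      finally show "(\<integral>\<^sup>+t. ennreal (norm (?F t p)) \<partial>halfline)
          \<le> ennreal (l2norm u * l2norm v * (l2norm (psi w p))\<^sup>2)"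
        by (simp add: ennreal_mult'[symmetric] mult_ac l2norm_cnj power2_eq_square)
    qed
    also have "\<dots> < \<infinity>"
      using HS_integrable by (subst nn_integral_eq_integral) auto
    finally show "(\<integral>\<^sup>+z. ennreal (norm (case z of (t, p) \<Rightarrow> ?F t p)) \<partial>(halfline \<Otimes>\<^sub>M M)) < \<infinity>" .
  qed
  have "l2_inner (weighted_hankel h w u) v = (\<integral>t. (\<integral>p. ?F t p \<partial>M) \<partial>halfline)"
    unfolding l2_inner_def
  proof (intro Bochner_Integration.integral_cong refl)
    fix t assume "t \<in> space halfline"
    then have t: "t > 0" by simp
    show "weighted_hankel h w u t * cnj (v t) = (\<integral>p. ?F t p \<partial>M)"
      unfolding weighted_hankel_eq[OF u t]
      by (subst Bochner_Integration.integral_mult_left_zero[symmetric])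
         (simp add: mult_ac)
  qed
  also have "\<dots> = (\<integral>p. (\<integral>t. ?F t p \<partial>halfline) \<partial>M)"
    by (rule Fubini_integral[symmetric, OF int])
  finally show ?thesis by (simp add: psi_transform_def)
qed

lemma weighted_hankel_form_le:
  assumes u: "u \<in> L2" and v: "v \<in> L2"
  shows "cmod (l2_inner (weighted_hankel h w u) v) \<le> sqrt (energy u) * sqrt (energy (\<lambda>t. cnj (v t)))"
proof -
  note v' = L2_cnj[OF v]
  have "cmod (l2_inner (weighted_hankel h w u) v)
      \<le> (\<integral>p. cmod (\<theta> p * psi_transform u p * psi_transform (\<lambda>t. cnj (v t)) p) \<partial>M)"
    unfolding weighted_hankel_form[OF assms] by (rule integral_norm_bound)
  also have "\<dots> = (\<integral>p. cmod (psi_transform u p) * cmod (psi_transform (\<lambda>t. cnj (v t)) p) \<partial>M)"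
    by (intro Bochner_Integration.integral_cong refl) (simp add: space_M norm_mult theta_norm)
  also have "\<dots> \<le> sqrt (energy u) * sqrt (energy (\<lambda>t. cnj (v t)))"
    unfolding energy_def
    by (intro integral_Cauchy_Schwarz energy_integrable psi_transform_measurable u v')
  finally show ?thesis .
qed

lemma nuclear_if_HS: "weighted_hankel_nuclear h w"
  unfolding weighted_hankel_nuclear_def hankel_defined_def
proof (intro conjI ballI)
  show "AE t in halfline. integrable halfline (hankel_integrand h w u t)" if "u \<in> L2" for u
    using hankel_integrand_integrable[OF that] by (intro AE_I2) simp
  show "nuclear (weighted_hankel h w)"
  proof (rule nuclear_if_quadratic_bound[where Q = energy and C = HSnorm2 and H = HSnorm2])
    show "energy (\<lambda>t. a * u t) = (cmod a)\<^sup>2 * energy u" for a u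
      by (simp add: energy_def psi_transform_scale norm_mult power_mult_distrib)
    show "0 \<le> energy u" for u
      unfolding energy_def by (intro integral_nonneg_AE) simp
  qed (fact weighted_hankel_bounded_op energy_le weighted_hankel_form_le energy_ortho_sum)+
qed

end

section \<open>Necessity\<close>

context laplace_hankel
begin

text \<open>On each piece of finite measure all averages of \<open>\<theta>\<close> are nonnegative
  reals, hence so is \<open>\<theta>\<close> almost everywhere there, and its modulus is 1.
  Countably many pieces cover the half-plane.\<close>

lemma AE_theta_eq_1:
  assumes "cm_nonneg M \<theta>" shows "AE p in M. \<theta> p = 1"
proof -
  obtain A :: "nat \<Rightarrow> complex set" where A: "range A \<subseteq> sets M" "(\<Union>i. A i) = space M"
    "\<And>i. emeasure M (A i) \<noteq> \<infinity>"
    using M2.sigma_finite by blast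
  have A_sets: "A i \<in> sets M" for i using A(1) by blast
  have "AE p in M. indicator (A i) p *\<^sub>R \<theta> p \<in> \<real>\<^sub>\<ge>\<^sub>0" for i
  proof (rule M2.averaging_theorem[OF _ closed_nonneg_Reals_complex])
    show "integrable M (\<lambda>p. indicator (A i) p *\<^sub>R \<theta> p)"
    proof (rule Bochner_Integration.integrable_bound)
      show "integrable M (indicator (A i) :: complex \<Rightarrow> real)"
        using A_sets A(3)[of i] by (simp add: top.not_eq_extremum)
      show "AE p in M. norm (indicator (A i) p *\<^sub>R \<theta> p) \<le> norm (indicator (A i) p :: real)"
        using theta_norm by (intro AE_I2) (auto simp: space_M)
    qed (use A_sets in measurable)
    fix B assume B: "B \<in> sets M"
    have "emeasure M (A i \<inter> B) < \<infinity>"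
      using A(3)[of i] emeasure_mono[of "A i \<inter> B" "A i" M] A_sets
      by (auto simp: less_top[symmetric] top_unique)
    then have "cm_integral M \<theta> (indicator (A i \<inter> B)) \<in> \<real>\<^sub>\<ge>\<^sub>0"
      using assms B A_sets by (simp add: cm_nonneg_def)
    also have "cm_integral M \<theta> (indicator (A i \<inter> B)) = (LINT p:B|M. indicator (A i) p *\<^sub>R \<theta> p)"
      unfolding cm_integral_def set_lebesgue_integral_def
      by (intro Bochner_Integration.integral_cong refl) (auto simp: indicator_def)
    finally show "(1 / measure M B) *\<^sub>R (LINT p:B|M. indicator (A i) p *\<^sub>R \<theta> p) \<in> \<real>\<^sub>\<ge>\<^sub>0"
      by (auto simp: complex_nonneg_Reals_iff)
  qed
  then have "AE p in M. \<forall>i. indicator (A i) p *\<^sub>R \<theta> p \<in> \<real>\<^sub>\<ge>\<^sub>0"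
    by (simp add: AE_all_countable)
  then show ?thesis
  proof (rule AE_mp, intro AE_I2 impI)
    fix p assume p: "p \<in> space M" and nonneg: "\<forall>i. indicator (A i) p *\<^sub>R \<theta> p \<in> \<real>\<^sub>\<ge>\<^sub>0"
    obtain i where "p \<in> A i" using p A(2) by blast
    with nonneg[rule_format, of i] have "\<theta> p \<in> \<real>\<^sub>\<ge>\<^sub>0" by simp
    moreover have "cmod (\<theta> p) = 1" using theta_norm p by (simp add: space_M)
    ultimately show "\<theta> p = 1"
      by (auto simp: complex_nonneg_Reals_iff complex_eq_iff cmod_def)
  qed
qed

lemma AE_Im_eq_0:
  assumes "supported_on_neg_reals M" shows "AE p in M. Im p = 0"
proof (rule AE_I)
  have eq: "{p \<in> space M. Im p \<noteq> 0} = left_half_plane - of_real ` {..<0}"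
  proof -
    have "p \<in> of_real ` {..<0}" if "Re p < 0" "Im p = 0" for p
      using that by (intro image_eqI[of _ _ "Re p"]) (auto simp: complex_eq_iff)
    then show ?thesis unfolding space_M left_half_plane_def by auto
  qed
  show "{p \<in> space M. Im p \<noteq> 0} \<in> sets M" by measurable
  show "emeasure M {p \<in> space M. Im p \<noteq> 0} = 0"
    using assms by (simp add: eq supported_on_neg_reals_def)
qed auto

text \<open>For \<open>t > 0\<close> the modulus of \<open>psi w p t\<close>. It depends on
  \<open>p\<close> only through \<open>Re p\<close>, so the integral formulas below make sense at
  every \<open>p\<close>, not just on the real axis.\<close>

definition phi :: "complex \<Rightarrow> real \<Rightarrow> real" where
  "phi p t = w t * exp (t * Re p)"

lemma phi_measurable [measurable]:
  "(\<lambda>(t, p). phi p t) \<in> borel_measurable (halfline \<Otimes>\<^sub>M M)"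
  "(\<lambda>(p, t). phi p t) \<in> borel_measurable (M \<Otimes>\<^sub>M halfline)"
  "phi p \<in> borel_measurable halfline"
  "(\<lambda>p. phi p t) \<in> borel_measurable M"
  unfolding phi_def by measurable

lemma phi_pos: "t > 0 \<Longrightarrow> phi p t > 0"
  by (simp add: phi_def w_pos)

lemma cmod_psi: "t > 0 \<Longrightarrow> cmod (psi w p t) = phi p t"
  using w_pos[of t] by (simp add: psi_def phi_def norm_mult mult.commute)

lemma
  assumes pos: "cm_nonneg M \<theta>" "supported_on_neg_reals M"
    and def: "hankel_defined h w" and G: "bounded_op (weighted_hankel h w)"
    and e: "(\<lambda>t. complex_of_real (e t)) \<in> L2" and e_nonneg: "\<And>t. 0 \<le> e t"
    and e_meas [measurable]: "e \<in> borel_measurable halfline"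
  shows positive_quadratic_form_nonneg:
      "0 \<le> Re (l2_inner (weighted_hankel h w (\<lambda>t. of_real (e t))) (\<lambda>t. of_real (e t)))"
    and positive_quadratic_form_eq:
      "ennreal (Re (l2_inner (weighted_hankel h w (\<lambda>t. of_real (e t))) (\<lambda>t. of_real (e t))))
        = (\<integral>\<^sup>+p. (\<integral>\<^sup>+t. ennreal (phi p t * e t) \<partial>halfline)\<^sup>2 \<partial>M)"
proof -
  let ?e = "\<lambda>t. complex_of_real (e t)"
  define k where "k s = (\<integral>p. exp (s * Re p) \<partial>M)" for s
  have exp_integrable: "integrable M (\<lambda>p. exp (s * Re p))" if "s > 0" for s
    using exp_int[OF that] by (intro integrableI_bounded) auto
  have k_nonneg: "0 \<le> k s" for s
    unfolding k_def by (intro integral_nonneg_AE) simp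
  \<comment> \<open>Almost every \<open>p\<close> is real with \<open>\<theta> p = 1\<close>, so
    \<open>h\<close> is a Laplace transform with nonnegative values.\<close>
  have h_eq: "h s = of_real (k s)" if "s > 0" for s
  proof -
    have "AE p in M. exp (of_real s * p) * \<theta> p = complex_of_real (exp (s * Re p))"
      using AE_theta_eq_1[OF pos(1)] AE_Im_eq_0[OF pos(2)]
    proof eventually_elim
      case (elim p)
      then have "p = of_real (Re p)" by (simp add: complex_eq_iff)
      then have "exp (of_real s * p) = complex_of_real (exp (s * Re p))"
        by (metis exp_of_real of_real_mult)
      then show ?case using elim by simp
    qed
    then have "(\<integral>p. exp (of_real s * p) * \<theta> p \<partial>M) = (\<integral>p. complex_of_real (exp (s * Re p)) \<partial>M)"
      by (intro integral_cong_AE) measurable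
    then show ?thesis using that by (simp add: h cm_integral_def k_def)
  qed
  have Ge: "weighted_hankel h w ?e \<in> L2" by (rule bounded_op_L2[OF G e])
  define K where "K t \<tau> = w t * k (t + \<tau>) * w \<tau> * e \<tau>" for t \<tau>
  have K_nonneg: "0 \<le> K t \<tau>" if "t > 0" "\<tau> > 0" for t \<tau>
    using that w_pos[of t] w_pos[of \<tau>] by (simp add: K_def k_nonneg e_nonneg)
  have K_eq: "hankel_integrand h w ?e t \<tau> = of_real (K t \<tau>)" if "t > 0" "\<tau> > 0" for t \<tau>
    using that by (simp add: hankel_integrand_def h_eq K_def)
  have K_nn: "ennreal (K t \<tau>) = (\<integral>\<^sup>+p. ennreal (phi p t) * ennreal (phi p \<tau> * e \<tau>) \<partial>M)"
    if t: "t > 0" and \<tau>: "\<tau> > 0" for t \<tau>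
  proof -
    have "ennreal (K t \<tau>) = ennreal (w t * w \<tau> * e \<tau>) * ennreal (k (t + \<tau>))"
      using w_pos[OF t] w_pos[OF \<tau>] e_nonneg[of \<tau>] k_nonneg
      by (simp add: K_def mult_ac flip: ennreal_mult)
    also have "ennreal (k (t + \<tau>)) = (\<integral>\<^sup>+p. ennreal (exp ((t + \<tau>) * Re p)) \<partial>M)"
      using exp_integrable[of "t + \<tau>"] t \<tau> by (simp add: k_def nn_integral_eq_integral)
    also have "ennreal (w t * w \<tau> * e \<tau>) * \<dots> = (\<integral>\<^sup>+p. ennreal (w t * w \<tau> * e \<tau>) * ennreal (exp ((t + \<tau>) * Re p)) \<partial>M)"
      by (rule nn_integral_cmult[symmetric]) measurable
    also have "\<dots> = (\<integral>\<^sup>+p. ennreal (phi p t) * ennreal (phi p \<tau> * e \<tau>) \<partial>M)"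
    proof (rule nn_integral_cong)
      fix p
      have "exp ((t + \<tau>) * Re p) = exp (t * Re p) * exp (\<tau> * Re p)"
        by (simp add: distrib_right exp_add)
      then show "ennreal (w t * w \<tau> * e \<tau>) * ennreal (exp ((t + \<tau>) * Re p))
          = ennreal (phi p t) * ennreal (phi p \<tau> * e \<tau>)"
        using w_pos[OF t] w_pos[OF \<tau>] e_nonneg[of \<tau>]
        by (simp add: phi_def mult_ac flip: ennreal_mult)
    qed
    finally show ?thesis .
  qed
  \<comment> \<open>Where the defining integral converges it agrees with the nonnegative integral of
    \<open>K t\<close>; elsewhere the Bochner integral would be 0 by convention.
    \<open>hankel_defined\<close> confines the latter to a null set.\<close>
  have Ge_eq: "AE t in halfline. weighted_hankel h w ?e t = of_real (Re (weighted_hankel h w ?e t)) \<and>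
      0 \<le> Re (weighted_hankel h w ?e t) \<and>
      ennreal (Re (weighted_hankel h w ?e t)) = (\<integral>\<^sup>+\<tau>. ennreal (K t \<tau>) \<partial>halfline)"
  proof -
    have "AE t in halfline. integrable halfline (hankel_integrand h w ?e t)"
      using def e by (simp add: hankel_defined_def)
    then show ?thesis
    proof (rule AE_mp, intro AE_I2 impI)
      fix t assume "t \<in> space halfline" and int: "integrable halfline (hankel_integrand h w ?e t)"
      then have t: "t > 0" by simp
      have "integrable halfline (hankel_integrand h w ?e t) = integrable halfline (\<lambda>\<tau>. complex_of_real (K t \<tau>))"
        using t by (intro Bochner_Integration.integrable_cong refl K_eq) auto
      then have K_int: "integrable halfline (K t)"
        using int complex_of_real_integrable_eq[of halfline "K t"] by blast
      have "weighted_hankel h w ?e t = (\<integral>\<tau>. complex_of_real (K t \<tau>) \<partial>halfline)"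
        unfolding weighted_hankel_def using t by (intro Bochner_Integration.integral_cong refl K_eq) auto
      then have eq: "weighted_hankel h w ?e t = of_real (\<integral>\<tau>. K t \<tau> \<partial>halfline)"
        by simp
      have "(\<integral>\<^sup>+\<tau>. ennreal (K t \<tau>) \<partial>halfline) = ennreal (\<integral>\<tau>. K t \<tau> \<partial>halfline)"
        using t K_nonneg by (intro nn_integral_eq_integral K_int AE_I2) auto
      moreover have "0 \<le> (\<integral>\<tau>. K t \<tau> \<partial>halfline)"
        using t K_nonneg by (intro integral_nonneg_AE AE_I2) auto
      ultimately show "weighted_hankel h w ?e t = of_real (Re (weighted_hankel h w ?e t)) \<and>
          0 \<le> Re (weighted_hankel h w ?e t) \<and>
          ennreal (Re (weighted_hankel h w ?e t)) = (\<integral>\<^sup>+\<tau>. ennreal (K t \<tau>) \<partial>halfline)"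
        unfolding eq by simp
    qed
  qed
  define X where "X p = (\<integral>\<^sup>+t. ennreal (phi p t * e t) \<partial>halfline)" for p
  have X_meas [measurable]: "X \<in> borel_measurable M"
    unfolding X_def[abs_def] by measurable
  have int: "integrable halfline (\<lambda>t. weighted_hankel h w ?e t * cnj (?e t))"
    by (intro L2_mult_integrable Ge L2_cnj e)
  have form: "Re (l2_inner (weighted_hankel h w ?e) ?e) = (\<integral>t. Re (weighted_hankel h w ?e t) * e t \<partial>halfline)"
    unfolding l2_inner_def by (subst integral_Re[symmetric, OF int]) simp
  have "integrable halfline (\<lambda>t. Re (weighted_hankel h w ?e t) * e t)"
    using integrable_Re[OF int] by simp
  moreover have nonneg: "AE t in halfline. 0 \<le> Re (weighted_hankel h w ?e t) * e t"
    using Ge_eq by eventually_elim (simp add: e_nonneg)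
  ultimately have "ennreal (Re (l2_inner (weighted_hankel h w ?e) ?e))
      = (\<integral>\<^sup>+t. ennreal (Re (weighted_hankel h w ?e t) * e t) \<partial>halfline)"
    unfolding form by (simp add: nn_integral_eq_integral)
  also have "\<dots> = (\<integral>\<^sup>+t. ennreal (e t) * (\<integral>\<^sup>+\<tau>. ennreal (K t \<tau>) \<partial>halfline) \<partial>halfline)"
    by (rule nn_integral_cong_AE, use Ge_eq in eventually_elim) (auto simp: ennreal_mult mult.commute e_nonneg)
  \<comment> \<open>Tonelli in \<open>\<tau>\<close> and \<open>p\<close>, afterwards in
    \<open>t\<close> and \<open>p\<close>; each half-line integral contributes one factor
    \<open>X p\<close>.\<close>
  also have "\<dots> = (\<integral>\<^sup>+t. (\<integral>\<^sup>+p. ennreal (phi p t * e t) * X p \<partial>M) \<partial>halfline)"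
  proof (rule nn_integral_cong)
    fix t assume "t \<in> space halfline"
    then have t: "t > 0" by simp
    have "(\<integral>\<^sup>+\<tau>. ennreal (K t \<tau>) \<partial>halfline)
        = (\<integral>\<^sup>+\<tau>. (\<integral>\<^sup>+p. ennreal (phi p t) * ennreal (phi p \<tau> * e \<tau>) \<partial>M) \<partial>halfline)"
      using t by (intro nn_integral_cong K_nn) auto
    also have "\<dots> = (\<integral>\<^sup>+p. (\<integral>\<^sup>+\<tau>. ennreal (phi p t) * ennreal (phi p \<tau> * e \<tau>) \<partial>halfline) \<partial>M)"
      by (rule Fubini'[symmetric]) measurable
    also have "\<dots> = (\<integral>\<^sup>+p. ennreal (phi p t) * X p \<partial>M)"
      unfolding X_def by (intro nn_integral_cong nn_integral_cmult) measurable
    finally have "ennreal (e t) * (\<integral>\<^sup>+\<tau>. ennreal (K t \<tau>) \<partial>halfline)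
        = (\<integral>\<^sup>+p. ennreal (e t) * (ennreal (phi p t) * X p) \<partial>M)"
      by (simp add: nn_integral_cmult)
    also have "\<dots> = (\<integral>\<^sup>+p. ennreal (phi p t * e t) * X p \<partial>M)"
      using phi_pos[OF t] e_nonneg[of t]
      by (intro nn_integral_cong) (simp add: less_imp_le ennreal_mult mult_ac)
    finally show "ennreal (e t) * (\<integral>\<^sup>+\<tau>. ennreal (K t \<tau>) \<partial>halfline)
        = (\<integral>\<^sup>+p. ennreal (phi p t * e t) * X p \<partial>M)" .
  qed
  also have "\<dots> = (\<integral>\<^sup>+p. (\<integral>\<^sup>+t. ennreal (phi p t * e t) * X p \<partial>halfline) \<partial>M)"
    by (rule Fubini'[symmetric]) measurable
  also have "\<dots> = (\<integral>\<^sup>+p. (X p)\<^sup>2 \<partial>M)"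
    by (intro nn_integral_cong) (simp add: nn_integral_multc power2_eq_square flip: X_def)
  finally show "ennreal (Re (l2_inner (weighted_hankel h w ?e) ?e))
      = (\<integral>\<^sup>+p. (\<integral>\<^sup>+t. ennreal (phi p t * e t) \<partial>halfline)\<^sup>2 \<partial>M)"
    unfolding X_def .
  show "0 \<le> Re (l2_inner (weighted_hankel h w ?e) ?e)"
    unfolding form using nonneg by (rule integral_nonneg_AE)
qed

text \<open>Since \<open>w\<close> is only measurable, its variation is controlled by its dyadic
  level sets, while the mesh \<open>1/n\<close> controls the exponential. Different index pairs give
  disjoint cells.\<close>

definition cell :: "nat \<Rightarrow> int \<times> int \<Rightarrow> real set" where
  "cell n c = {t. t > 0 \<and> \<lfloor>log 2 (w t)\<rfloor> = fst c \<and> \<lfloor>real n * t\<rfloor> = snd c}"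

lemma cell_sets [measurable]: "cell n c \<in> sets halfline"
proof -
  have "{t \<in> space halfline. \<lfloor>log 2 (w t)\<rfloor> = fst c \<and> \<lfloor>real n * t\<rfloor> = snd c} \<in> sets halfline"
    by measurable
  then show ?thesis by (simp add: cell_def)
qed

lemma emeasure_cell_finite:
  assumes "n > 0" shows "emeasure halfline (cell n c) < \<infinity>"
proof -
  have "cell n c \<subseteq> {0<..<(real_of_int (snd c) + 1) / real n}"
    using assms by (auto simp: cell_def field_simps floor_eq_iff)
  then have sub: "cell n c \<subseteq> {0..(real_of_int (snd c) + 1) / real n}" by auto
  have "emeasure halfline (cell n c) = emeasure lebesgue (cell n c)"
    by (rule emeasure_restrict_space) (auto simp: cell_def)
  also have "\<dots> \<le> emeasure lebesgue {0..(real_of_int (snd c) + 1) / real n}"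
    using sub by (intro emeasure_mono) auto
  also have "\<dots> < \<infinity>" by (simp add: emeasure_lborel_Icc_eq)
  finally show ?thesis .
qed

text \<open>The factor 2 comes from the dyadic level of \<open>w\<close>. The factor
  \<open>exp 1\<close> comes from the exponential: points of a cell are less than \<open>1/n\<close>
  apart and \<open>\<bar>Re p\<bar>\<close> is at most \<open>n\<close>.\<close>

lemma phi_comparable_on_cell:
  assumes "n > 0" "t \<in> cell n c" "s \<in> cell n c" "- real n \<le> Re p" "Re p < 0"
  shows "phi p t \<le> 2 * exp 1 * phi p s"
proof -
  have pos: "t > 0" "s > 0" "w t > 0" "w s > 0" using assms w_pos by (auto simp: cell_def)
  have "log 2 (w t) < log 2 (w s) + 1" "real n * s < real n * t + 1"
    using assms(2,3) by (auto simp: cell_def) linarith+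
  have "w t = 2 powr log 2 (w t)" using pos by simp
  also have "\<dots> \<le> 2 powr (log 2 (w s) + 1)"
    using \<open>log 2 (w t) < log 2 (w s) + 1\<close> by simp
  also have "\<dots> = 2 * w s" using pos by (simp add: powr_add)
  finally have w: "w t \<le> 2 * w s" .
  have "(s - t) * (- Re p) \<le> 1"
  proof (cases "s \<le> t")
    case True
    then have "(s - t) * (- Re p) \<le> 0" using assms(5) by (intro mult_nonpos_nonneg) auto
    then show ?thesis by linarith
  next
    case False
    then have "(s - t) * (- Re p) \<le> (s - t) * real n" using assms(4) by (intro mult_left_mono) auto
    then show ?thesis using \<open>real n * s < real n * t + 1\<close> by (simp add: algebra_simps)
  qed
  then have "t * Re p \<le> 1 + s * Re p" by (simp add: algebra_simps)
  then have "exp (t * Re p) \<le> exp 1 * exp (s * Re p)" by (simp flip: exp_add)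
  with w have "w t * exp (t * Re p) \<le> (2 * w s) * (exp 1 * exp (s * Re p))"
    using pos by (intro mult_mono) auto
  then show ?thesis by (simp add: phi_def mult_ac)
qed

text \<open>Normalized to norm 1 when the cell has positive measure; on a cell of measure 0 division
  by zero makes it the zero function.\<close>

definition cell_fun :: "nat \<Rightarrow> int \<times> int \<Rightarrow> real \<Rightarrow> real" where
  "cell_fun n c t = indicator (cell n c) t / sqrt (measure halfline (cell n c))"

lemma cell_fun_measurable [measurable]: "cell_fun n c \<in> borel_measurable halfline"
  unfolding cell_fun_def by measurable

lemma cell_fun_nonneg: "0 \<le> cell_fun n c t"
  by (simp add: cell_fun_def)

lemma cell_fun_mult:
  "cell_fun n c t * cell_fun n d t
    = (if c = d then indicator (cell n c) t / measure halfline (cell n c) else 0)"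
proof -
  have "t \<notin> cell n d" if "t \<in> cell n c" "c \<noteq> d"
    using that by (auto simp: cell_def prod_eq_iff)
  then show ?thesis by (auto simp: cell_fun_def indicator_def)
qed

lemma cell_indicator_integrable:
  "n > 0 \<Longrightarrow> integrable halfline (indicator (cell n c) :: real \<Rightarrow> real)"
  using emeasure_cell_finite[of n c] by simp

lemma cell_fun_L2: "n > 0 \<Longrightarrow> (\<lambda>t. complex_of_real (cell_fun n c t)) \<in> L2"
  using cell_indicator_integrable[of n c] by (simp add: L2_def power2_eq_square cell_fun_mult)

lemma l2_inner_cell_fun:
  assumes "n > 0" "measure halfline (cell n c) > 0"
  shows "l2_inner (\<lambda>t. of_real (cell_fun n c t)) (\<lambda>t. of_real (cell_fun n d t)) = (if c = d then 1 else 0)"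
proof -
  have "l2_inner (\<lambda>t. of_real (cell_fun n c t)) (\<lambda>t. of_real (cell_fun n d t))
      = of_real (\<integral>t. cell_fun n c t * cell_fun n d t \<partial>halfline)"
    by (simp add: l2_inner_def flip: of_real_mult)
  also have "\<dots> = (if c = d then 1 else 0)"
  proof -
    have "cell n c \<inter> {0<..} = cell n c" by (auto simp: cell_def)
    then show ?thesis using assms by (cases "c = d") (simp_all add: cell_fun_mult)
  qed
  finally show ?thesis .
qed

text \<open>A reverse Cauchy-Schwarz inequality: \<open>phi p\<close> is nearly constant on the
  cell, so its square integral there is controlled by its squared pairing with the normalized
  indicator. The constant is the square of \<open>2 * exp 1\<close>.\<close>

lemma cell_energy_le:
  assumes n: "n > 0" and m: "measure halfline (cell n c) > 0" and p: "- real n \<le> Re p" "Re p < 0"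
  shows "(\<integral>\<^sup>+t. ennreal ((phi p t)\<^sup>2) * indicator (cell n c) t \<partial>halfline)
    \<le> ennreal (4 * exp 2) * (\<integral>\<^sup>+t. ennreal (phi p t * cell_fun n c t) \<partial>halfline)\<^sup>2"
proof -
  define m where "m = measure halfline (cell n c)"
  have "m > 0" using m by (simp add: m_def)
  define X where "X = (\<integral>\<^sup>+t. ennreal (phi p t * cell_fun n c t) \<partial>halfline)"
  have emeasure_eq: "emeasure halfline (cell n c) = ennreal m"
    using emeasure_cell_finite[OF n, of c] by (simp add: m_def emeasure_eq_ennreal_measure top.not_eq_extremum)
  have int_cell: "(\<integral>\<^sup>+s. ennreal (cell_fun n c s) \<partial>halfline) = ennreal (sqrt m)"
  proof -
    have "(\<integral>\<^sup>+s. ennreal (cell_fun n c s) \<partial>halfline)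
        = (\<integral>\<^sup>+s. ennreal (1 / sqrt m) * indicator (cell n c) s \<partial>halfline)"
      by (intro nn_integral_cong) (auto simp: cell_fun_def m_def indicator_def)
    also have "\<dots> = ennreal (1 / sqrt m * m)"
      using \<open>m > 0\<close> by (simp add: nn_integral_cmult_indicator emeasure_eq flip: ennreal_mult)
    also have "1 / sqrt m * m = sqrt m" using \<open>m > 0\<close> by (simp add: real_div_sqrt)
    finally show ?thesis .
  qed
  \<comment> \<open>\<open>phi p t * sqrt m\<close> is the integral of the constant
    \<open>phi p t\<close> against the cell function; comparability on the cell replaces the
    constant by \<open>phi p s\<close>.\<close>
  have sup: "ennreal (phi p t * sqrt m) \<le> ennreal (2 * exp 1) * X" if t: "t \<in> cell n c" for t
  proof -
    have "t > 0" using t by (simp add: cell_def)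
    then have "ennreal (phi p t * sqrt m) = (\<integral>\<^sup>+s. ennreal (phi p t) * ennreal (cell_fun n c s) \<partial>halfline)"
      using phi_pos[of t p] \<open>m > 0\<close> by (simp add: nn_integral_cmult int_cell ennreal_mult)
    also have "\<dots> \<le> (\<integral>\<^sup>+s. ennreal (2 * exp 1) * ennreal (phi p s * cell_fun n c s) \<partial>halfline)"
    proof (rule nn_integral_mono)
      fix s
      have "phi p t * cell_fun n c s \<le> 2 * exp 1 * (phi p s * cell_fun n c s)"
      proof (cases "s \<in> cell n c")
        case True
        then show ?thesis
          using mult_right_mono[OF phi_comparable_on_cell[OF n t True p] cell_fun_nonneg[of n c s]]
          by (simp add: mult_ac)
      qed (simp add: cell_fun_def)
      then show "ennreal (phi p t) * ennreal (cell_fun n c s)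
          \<le> ennreal (2 * exp 1) * ennreal (phi p s * cell_fun n c s)"
        using phi_pos[OF \<open>t > 0\<close>, of p] cell_fun_nonneg[of n c s]
        by (simp add: ennreal_leI flip: ennreal_mult ennreal_mult')
    qed
    also have "\<dots> = ennreal (2 * exp 1) * X"
      unfolding X_def by (rule nn_integral_cmult) measurable
    finally show ?thesis .
  qed
  have "(\<integral>\<^sup>+t. ennreal ((phi p t)\<^sup>2) * indicator (cell n c) t \<partial>halfline)
      \<le> (\<integral>\<^sup>+t. ((ennreal (2 * exp 1) * X)\<^sup>2 * ennreal (1 / m)) * indicator (cell n c) t \<partial>halfline)"
  proof (rule nn_integral_mono)
    fix t
    have "ennreal ((phi p t)\<^sup>2) \<le> (ennreal (2 * exp 1) * X)\<^sup>2 * ennreal (1 / m)" if t: "t \<in> cell n c"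
    proof -
      have "t > 0" using t by (simp add: cell_def)
      have "ennreal ((phi p t)\<^sup>2) = (ennreal (phi p t * sqrt m))\<^sup>2 * ennreal (1 / m)"
        using \<open>m > 0\<close> phi_pos[OF \<open>t > 0\<close>, of p]
        by (simp add: ennreal_power power_mult_distrib flip: ennreal_mult)
      also have "\<dots> \<le> (ennreal (2 * exp 1) * X)\<^sup>2 * ennreal (1 / m)"
        by (intro mult_right_mono power_mono sup t) auto
      finally show ?thesis .
    qed
    then show "ennreal ((phi p t)\<^sup>2) * indicator (cell n c) t
        \<le> ((ennreal (2 * exp 1) * X)\<^sup>2 * ennreal (1 / m)) * indicator (cell n c) t"
      by (cases "t \<in> cell n c") auto
  qed
  also have "\<dots> = (ennreal (2 * exp 1) * X)\<^sup>2 * (ennreal (1 / m) * ennreal m)"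
    by (subst nn_integral_cmult_indicator) (simp_all add: emeasure_eq mult.assoc)
  also have "ennreal (1 / m) * ennreal m = 1"
    using \<open>m > 0\<close> by (simp flip: ennreal_mult)
  also have "(ennreal (2 * exp 1) * X)\<^sup>2 = ennreal (4 * exp 2) * X\<^sup>2"
    by (simp add: power_mult_distrib ennreal_power power2_eq_square[of "exp _"] flip: exp_add)
  finally show ?thesis by (simp add: X_def)
qed

text \<open>Bounded in \<open>Re p\<close>, in \<open>t\<close> and in the dyadic level of
  \<open>w\<close>, so that finitely many cells of mesh \<open>1/n\<close> suffice to cover its
  sections in \<open>t\<close>.\<close>

definition truncation :: "nat \<Rightarrow> (complex \<times> real) set" where
  "truncation n = {(p, t). - real n \<le> Re p \<and> Re p < 0 \<and> 0 < t \<and> t < real n \<and>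
     - int n \<le> \<lfloor>log 2 (w t)\<rfloor> \<and> \<lfloor>log 2 (w t)\<rfloor> < int n}"

text \<open>The point is that \<open>C\<close> is independent of \<open>n\<close>: the trace bound
  is uniform over all finite orthonormal families, and the cell functions of each mesh form
  one.\<close>

lemma truncated_energy_le:
  assumes pos: "cm_nonneg M \<theta>" "supported_on_neg_reals M"
    and def: "hankel_defined h w" and nuc: "nuclear (weighted_hankel h w)"
  obtains C where "\<And>n. n > 0 \<Longrightarrow>
    (\<integral>\<^sup>+p. (\<integral>\<^sup>+t. ennreal ((phi p t)\<^sup>2) * indicator (truncation n) (p, t) \<partial>halfline) \<partial>M) \<le> ennreal C"
proof -
  let ?G = "weighted_hankel h w"
  have G: "bounded_op ?G" using nuc by (simp add: nuclear_def)
  obtain C where C: "\<And>J (e :: int \<times> int \<Rightarrow> real \<Rightarrow> complex). finite J \<Longrightarrow> (\<And>j. j \<in> J \<Longrightarrow> e j \<in> L2) \<Longrightarrow>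
     (\<And>i j. i \<in> J \<Longrightarrow> j \<in> J \<Longrightarrow> l2_inner (e i) (e j) = (if i = j then 1 else 0)) \<Longrightarrow>
     cmod (\<Sum>j\<in>J. l2_inner (?G (e j)) (e j)) \<le> C"
    using nuclear_trace_bound[OF nuc] by blast
  show ?thesis
  proof
    fix n :: nat assume n: "n > 0"
    \<comment> \<open>For \<open>0 < t < n\<close> the index of \<open>t\<close> in the mesh
      \<open>1/n\<close> lies below \<open>n * n\<close>.\<close>
    define J0 where "J0 = {- int n..<int n} \<times> {0..<int (n * n)}"
    \<comment> \<open>Cells of measure 0 are discarded: their functions are not unit vectors, and
      their integrals vanish.\<close>
    define J where "J = {c \<in> J0. measure halfline (cell n c) > 0}"
    define e where "e c = (\<lambda>t. complex_of_real (cell_fun n c t))" for c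
    define X where "X c p = (\<integral>\<^sup>+t. ennreal (phi p t * cell_fun n c t) \<partial>halfline)" for c p
    have [measurable]: "X c \<in> borel_measurable M" for c
      unfolding X_def[abs_def] by measurable
    have fin: "finite J0" "finite J" by (simp_all add: J0_def J_def)
    have "(\<integral>\<^sup>+t. ennreal ((phi p t)\<^sup>2) * indicator (truncation n) (p, t) \<partial>halfline)
        \<le> (\<Sum>c\<in>J. ennreal (4 * exp 2) * (X c p)\<^sup>2)" for p
    proof (cases "- real n \<le> Re p \<and> Re p < 0")
      case True
      have "(\<integral>\<^sup>+t. ennreal ((phi p t)\<^sup>2) * indicator (truncation n) (p, t) \<partial>halfline)
          \<le> (\<integral>\<^sup>+t. (\<Sum>c\<in>J0. ennreal ((phi p t)\<^sup>2) * indicator (cell n c) t) \<partial>halfline)"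
      proof (rule nn_integral_mono)
        fix t
        show "ennreal ((phi p t)\<^sup>2) * indicator (truncation n) (p, t)
            \<le> (\<Sum>c\<in>J0. ennreal ((phi p t)\<^sup>2) * indicator (cell n c) t)"
        proof (cases "(p, t) \<in> truncation n")
          case True
          define c where "c = (\<lfloor>log 2 (w t)\<rfloor>, \<lfloor>real n * t\<rfloor>)"
          have t: "0 < t" "t < real n" using True by (auto simp: truncation_def)
          have "real n * t < real (n * n)" using t n by simp
          then have "\<lfloor>real n * t\<rfloor> < int (n * n)" by (simp add: floor_less_iff)
          then have "c \<in> J0" using True t by (auto simp: truncation_def J0_def c_def)
          moreover have "t \<in> cell n c" using t by (simp add: cell_def c_def)
          ultimately show ?thesis
            using True member_le_sum[of c J0 "\<lambda>c. ennreal ((phi p t)\<^sup>2) * indicator (cell n c) t"] fin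
            by simp
        qed simp
      qed
      also have "\<dots> = (\<Sum>c\<in>J0. \<integral>\<^sup>+t. ennreal ((phi p t)\<^sup>2) * indicator (cell n c) t \<partial>halfline)"
        by (rule nn_integral_sum) measurable
      also have "\<dots> = (\<Sum>c\<in>J. \<integral>\<^sup>+t. ennreal ((phi p t)\<^sup>2) * indicator (cell n c) t \<partial>halfline)"
      proof (rule sum.mono_neutral_right)
        show "\<forall>c\<in>J0 - J. (\<integral>\<^sup>+t. ennreal ((phi p t)\<^sup>2) * indicator (cell n c) t \<partial>halfline) = 0"
        proof
          fix c assume "c \<in> J0 - J"
          then have "measure halfline (cell n c) = 0"
            using measure_nonneg[of halfline "cell n c"] by (auto simp: J_def)
          then have "emeasure halfline (cell n c) = 0"
            using emeasure_cell_finite[OF n, of c] by (simp add: emeasure_eq_ennreal_measure top.not_eq_extremum)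
          then have "cell n c \<in> null_sets halfline" by (intro null_setsI) simp_all
          then show "(\<integral>\<^sup>+t. ennreal ((phi p t)\<^sup>2) * indicator (cell n c) t \<partial>halfline) = 0"
            by (rule nn_integral_null_set)
        qed
      qed (use fin in \<open>auto simp: J_def\<close>)
      also have "\<dots> \<le> (\<Sum>c\<in>J. ennreal (4 * exp 2) * (X c p)\<^sup>2)"
        unfolding X_def using True by (intro sum_mono cell_energy_le n) (auto simp: J_def)
      finally show ?thesis .
    next
      case False
      then have "(p, t) \<notin> truncation n" for t by (auto simp: truncation_def)
      then show ?thesis by simp
    qed
    then have "(\<integral>\<^sup>+p. (\<integral>\<^sup>+t. ennreal ((phi p t)\<^sup>2) * indicator (truncation n) (p, t) \<partial>halfline) \<partial>M)
        \<le> (\<integral>\<^sup>+p. (\<Sum>c\<in>J. ennreal (4 * exp 2) * (X c p)\<^sup>2) \<partial>M)"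
      by (rule nn_integral_mono)
    also have "\<dots> = ennreal (4 * exp 2) * (\<Sum>c\<in>J. \<integral>\<^sup>+p. (X c p)\<^sup>2 \<partial>M)"
      by (simp add: nn_integral_sum nn_integral_cmult sum_distrib_left)
    also have "(\<Sum>c\<in>J. \<integral>\<^sup>+p. (X c p)\<^sup>2 \<partial>M) = (\<Sum>c\<in>J. ennreal (Re (l2_inner (?G (e c)) (e c))))"
      unfolding X_def e_def
      by (intro sum.cong refl positive_quadratic_form_eq[symmetric] pos def G cell_fun_L2 n cell_fun_nonneg)
         measurable
    also have "\<dots> \<le> ennreal C"
    proof -
      \<comment> \<open>Since all diagonal terms are nonnegative, their sum in
        \<open>ennreal\<close> is the real part of the trace, which the trace bound
        controls.\<close>
      have "0 \<le> Re (l2_inner (?G (e c)) (e c))" if "c \<in> J" for c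
        unfolding e_def
        by (intro positive_quadratic_form_nonneg pos def G cell_fun_L2 n cell_fun_nonneg) measurable
      then have "(\<Sum>c\<in>J. ennreal (Re (l2_inner (?G (e c)) (e c)))) = ennreal (Re (\<Sum>c\<in>J. l2_inner (?G (e c)) (e c)))"
        by simp
      also have "\<dots> \<le> ennreal (cmod (\<Sum>c\<in>J. l2_inner (?G (e c)) (e c)))"
        by (intro ennreal_leI complex_Re_le_cmod)
      also have "\<dots> \<le> ennreal C"
        unfolding e_def
        by (intro ennreal_leI C fin cell_fun_L2 n l2_inner_cell_fun) (simp add: J_def)
      finally show ?thesis .
    qed
    finally show "(\<integral>\<^sup>+p. (\<integral>\<^sup>+t. ennreal ((phi p t)\<^sup>2) * indicator (truncation n) (p, t) \<partial>halfline) \<partial>M)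
        \<le> ennreal (4 * exp 2 * C)"
      by (simp add: ennreal_mult' mult_left_mono)
  qed
qed

section \<open>Removal of the truncation\<close>

lemma truncation_mono: "m \<le> n \<Longrightarrow> truncation m \<subseteq> truncation n"
  unfolding truncation_def by auto

lemma truncation_exhausts:
  assumes "Re p < 0" "t > 0" shows "\<exists>n. (p, t) \<in> truncation (Suc n)"
proof -
  obtain n1 where n1: "\<bar>Re p\<bar> + t \<le> real n1" using real_arch_simple by blast
  define n where "n = max n1 (nat (\<bar>\<lfloor>log 2 (w t)\<rfloor>\<bar>))"
  have "\<bar>Re p\<bar> + t \<le> real n" "\<bar>\<lfloor>log 2 (w t)\<rfloor>\<bar> \<le> int n" using n1 by (auto simp: n_def)
  then show ?thesis using assms by (intro exI[of _ n]) (auto simp: truncation_def)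
qed

lemma HS_if_nuclear:
  assumes pos: "cm_nonneg M \<theta>" "supported_on_neg_reals M"
    and nuc: "weighted_hankel_nuclear h w"
  shows "(\<integral>\<^sup>+p. ennreal ((l2norm (psi w p))\<^sup>2) \<partial>M) < \<infinity>"
proof -
  obtain C where C: "\<And>n. n > 0 \<Longrightarrow>
      (\<integral>\<^sup>+p. (\<integral>\<^sup>+t. ennreal ((phi p t)\<^sup>2) * indicator (truncation n) (p, t) \<partial>halfline) \<partial>M) \<le> ennreal C"
    using truncated_energy_le[OF pos] nuc unfolding weighted_hankel_nuclear_def by blast
  \<comment> \<open>The index is shifted to \<open>Suc n\<close> because the uniform bound is
    available for positive \<open>n\<close> only.\<close>
  define f where "f n z = ennreal ((phi (fst z) (snd z))\<^sup>2) * indicator (truncation (Suc n)) z" for n z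
  have trunc: "{z \<in> space (M \<Otimes>\<^sub>M halfline). z \<in> truncation n} \<in> sets (M \<Otimes>\<^sub>M halfline)" for n
    unfolding truncation_def split_beta' mem_Collect_eq by measurable
  have f_meas [measurable]: "f n \<in> borel_measurable (M \<Otimes>\<^sub>M halfline)" for n
  proof -
    have "(\<lambda>z. ennreal ((phi (fst z) (snd z))\<^sup>2) * indicator {z \<in> space (M \<Otimes>\<^sub>M halfline). z \<in> truncation (Suc n)} z)
        \<in> borel_measurable (M \<Otimes>\<^sub>M halfline)"
      using trunc[of "Suc n"] phi_measurable(2) by (simp add: split_beta')
    moreover have "f n z = ennreal ((phi (fst z) (snd z))\<^sup>2) *
        indicator {z \<in> space (M \<Otimes>\<^sub>M halfline). z \<in> truncation (Suc n)} z"
      if "z \<in> space (M \<Otimes>\<^sub>M halfline)" for z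
      using that by (simp add: f_def indicator_def)
    ultimately show ?thesis by (subst measurable_cong) auto
  qed
  have "incseq f"
    unfolding f_def incseq_def le_fun_def
    using truncation_mono by (auto simp: indicator_def intro!: mult_left_mono) (meson Suc_le_mono subsetD)
  have "(\<integral>\<^sup>+p. ennreal ((l2norm (psi w p))\<^sup>2) \<partial>M)
      = (\<integral>\<^sup>+p. (\<integral>\<^sup>+t. ennreal ((phi p t)\<^sup>2) \<partial>halfline) \<partial>M)"
    by (intro nn_integral_cong)
       (auto simp: space_M psi_L2 cmod_psi nn_integral_L2[symmetric] intro!: nn_integral_cong)
  also have "\<dots> \<le> (\<integral>\<^sup>+p. (\<integral>\<^sup>+t. (SUP n. f n (p, t)) \<partial>halfline) \<partial>M)"
  proof (intro nn_integral_mono)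
    fix p t assume "p \<in> space M" "t \<in> space halfline"
    then obtain n where "(p, t) \<in> truncation (Suc n)"
      using truncation_exhausts[of p t] by (auto simp: space_M left_half_plane_def)
    then have "ennreal ((phi p t)\<^sup>2) = f n (p, t)" by (simp add: f_def)
    also have "\<dots> \<le> (SUP n. f n (p, t))" by (rule SUP_upper) simp
    finally show "ennreal ((phi p t)\<^sup>2) \<le> (SUP n. f n (p, t))" .
  qed
  \<comment> \<open>On the product measure a single application of monotone convergence handles
    \<open>p\<close> and \<open>t\<close> together.\<close>
  also have "\<dots> = (\<integral>\<^sup>+z. (SUP n. f n z) \<partial>(M \<Otimes>\<^sub>M halfline))"
    by (rule M1.nn_integral_fst) measurable
  also have "\<dots> = (SUP n. \<integral>\<^sup>+z. f n z \<partial>(M \<Otimes>\<^sub>M halfline))"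
    by (rule nn_integral_monotone_convergence_SUP[OF \<open>incseq f\<close>]) measurable
  also have "\<dots> \<le> ennreal C"
  proof (rule SUP_least)
    fix n
    have "(\<integral>\<^sup>+z. f n z \<partial>(M \<Otimes>\<^sub>M halfline)) = (\<integral>\<^sup>+p. (\<integral>\<^sup>+t. f n (p, t) \<partial>halfline) \<partial>M)"
      by (rule M1.nn_integral_fst[symmetric]) measurable
    also have "\<dots> \<le> ennreal C" using C[of "Suc n"] by (simp add: f_def)
    finally show "(\<integral>\<^sup>+z. f n z \<partial>(M \<Otimes>\<^sub>M halfline)) \<le> ennreal C" .
  qed
  finally show ?thesis by (simp add: le_less_trans)
qed

end

theorem theorem2p2:
  fixes M :: "complex measure" and \<theta> :: "complex \<Rightarrow> complex"
    and h :: "real \<Rightarrow> complex" and w :: "real \<Rightarrow> real"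
  assumes mu: "sigma_finite_complex_measure M \<theta>"
    and exp_int: "\<And>t. t > 0 \<Longrightarrow> (\<integral>\<^sup>+p. ennreal (cmod (exp (of_real t * p))) \<partial>M) < \<infinity>"
    and h: "\<And>t. t > 0 \<Longrightarrow> h t = cm_integral M \<theta> (\<lambda>p. exp (of_real t * p))"
    and w_meas: "w \<in> borel_measurable (lebesgue_on {0<..})"
    and w_pos: "\<And>t. t > 0 \<Longrightarrow> w t > 0"
    and psi_L2: "\<And>p. p \<in> left_half_plane \<Longrightarrow> psi w p \<in> L2"
  shows "((\<integral>\<^sup>+p. ennreal ((l2norm (psi w p))\<^sup>2) \<partial>M) < \<infinity> \<longrightarrow> weighted_hankel_nuclear h w) \<and>
         (cm_nonneg M \<theta> \<and> supported_on_neg_reals M \<longrightarrow>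
            ((\<integral>\<^sup>+p. ennreal ((l2norm (psi w p))\<^sup>2) \<partial>M) < \<infinity> \<longleftrightarrow> weighted_hankel_nuclear h w))"
proof -
  interpret laplace_hankel M \<theta> h w
    by unfold_locales (fact assms)+
  have "weighted_hankel_nuclear h w" if "(\<integral>\<^sup>+p. ennreal ((l2norm (psi w p))\<^sup>2) \<partial>M) < \<infinity>"
  proof -
    interpret laplace_hankel_HS M \<theta> h w
      by unfold_locales (fact that)
    show ?thesis by (rule nuclear_if_HS)
  qed
  then show ?thesis using HS_if_nuclear by blast
qed

end
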